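(* Let $1<p<\infty$ and $0\leq\lambda<n$. Then each of the operators $M$, $M^\sharp$, $H$, $\mathcal{H}$ and $S$ is bounded in $V_\infty L^{p,\lambda}(\mathbb{R}^n)$; that is, each maps $V_\infty L^{p,\lambda}(\mathbb{R}^n)$ into itself with $\|Tf\|_{p,\lambda}\leq C\|f\|_{p,\lambda}$ for a constant $C$ independent of $f$, where $T$ is any of these operators.
   Context: For $x\in\mathbb{R}^n$, $r>0$, let $B(x,r)$ be the open ball and $\mathfrak{M}_{p,\lambda}(f;x,r):=\frac{1}{r^\lambda}\int_{B(x,r)}|f(y)|^p\,dy$. The Morrey space $L^{p,\lambda}(\mathbb{R}^n)$ consists of all locally $p$-integrable $f$ on $\mathbb{R}^n$ with $\|f\|_{p,\lambda}:=\sup_{x\in\mathbb{R}^n,\,r>0}\mathfrak{M}_{p,\lambda}(f;x,r)^{1/p}<\infty$. The subspace $V_\infty L^{p,\lambda}(\mathbb{R}^n)$ consists of all $f\in L^{p,\lambda}(\mathbb{R}^n)$ with $\lim_{r\to\infty}\sup_{x\in\mathbb{R}^n}\mathfrak{M}_{p,\lambda}(f;x,r)=0$. Operators: - Hardy-Littlewood maximal operator $Mf(x):=\sup_{t>0}\frac{1}{|B(x,t)|}\int_{B(x,t)}|f(y)|\,dy$. - Sharp maximal function $M^\sharp f(x):=\sup_{t>0}\frac{1}{|B(x,t)|}\int_{B(x,t)}|f(y)-f_{B(x,t)}|\,dy$, where $f_B=\frac{1}{|B|}\int_B f(z)\,dz$. - Hardy operators $Hf(x):=\frac{1}{|x|^n}\int_{|y|<|x|}f(y)\,dy$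 and $\mathcal{H}f(x):=\int_{|y|>|x|}\frac{f(y)}{|y|^n}\,dy$. - $S$ denotes any singular integral operator $Sf(x):=\lim_{\varepsilon\to0}\int_{|x-y|>\varepsilon}K(x,y)f(y)\,dy$ (the limit being understood to exist for a.e. $x$ for $f\in L^p(\mathbb{R}^n)$) which is bounded in $L^p(\mathbb{R}^n)$ and whose measurable kernel satisfies $|K(x,y)|\leq c\,|x-y|^{-n}$ for all $x\neq y$, with a constant $c>0$. *)

theory Defs
  imports "HOL-Analysis.Analysis"
begin

text \<open>
  Functions are scalar-valued on \<open>real^'n\<close>, and all integrals are taken with respect to Lebesgue
  measure, i.e. the completed measure \<open>lebesgue\<close>: several operators below determine a function only
  almost everywhere, which is compatible with Lebesgue but not with Borel measurability.
\<close>

definition Lp_space :: "real \<Rightarrow> (real^'n \<Rightarrow> 'b::real_normed_vector) set" where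
  "Lp_space p = {f. f \<in> borel_measurable lebesgue \<and> integrable lebesgue (\<lambda>y. norm (f y) powr p)}"

definition Lp_norm :: "real \<Rightarrow> (real^'n \<Rightarrow> 'b::real_normed_vector) \<Rightarrow> real" where
  "Lp_norm p f = (LINT y|lebesgue. norm (f y) powr p) powr (1 / p)"

definition morrey_modular ::
  "real \<Rightarrow> real \<Rightarrow> (real^'n \<Rightarrow> 'b::real_normed_vector) \<Rightarrow> real^'n \<Rightarrow> real \<Rightarrow> real" where
  "morrey_modular p lam f x r = 1 / r powr lam * (LINT y:ball x r|lebesgue. norm (f y) powr p)"

text \<open>The suprema below are real-valued; in \<open>morrey_space\<close> finiteness of the norm is expressed by
  \<open>bdd_above\<close>, so that they are genuine suprema for members of that space.\<close>

definition morrey_norm :: "real \<Rightarrow> real \<Rightarrow> (real^'n \<Rightarrow> 'b::real_normed_vector) \<Rightarrow> real" where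
  "morrey_norm p lam f = (SUP (x, r)\<in>UNIV \<times> {0<..}. morrey_modular p lam f x r powr (1 / p))"

definition morrey_space :: "real \<Rightarrow> real \<Rightarrow> (real^'n \<Rightarrow> 'b::real_normed_vector) set" where
  "morrey_space p lam = {f.
     f \<in> borel_measurable lebesgue \<and>
     (\<forall>A. compact A \<longrightarrow> set_integrable lebesgue A (\<lambda>y. norm (f y) powr p)) \<and>
     bdd_above ((\<lambda>(x, r). morrey_modular p lam f x r powr (1 / p)) ` (UNIV \<times> {0<..}))}"

definition vanishing_morrey_space ::
  "real \<Rightarrow> real \<Rightarrow> (real^'n \<Rightarrow> 'b::real_normed_vector) set" where
  "vanishing_morrey_space p lam = {f \<in> morrey_space p lam.
     ((\<lambda>r. SUP x. morrey_modular p lam f x r) \<longlongrightarrow> 0) at_top}"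

definition bounded_on_Lp ::
  "real \<Rightarrow> ((real^'n \<Rightarrow> 'a::real_normed_vector) \<Rightarrow> (real^'n \<Rightarrow> 'b::real_normed_vector)) \<Rightarrow> bool" where
  "bounded_on_Lp p T \<longleftrightarrow>
     (\<exists>C. \<forall>f\<in>Lp_space p. T f \<in> Lp_space p \<and> Lp_norm p (T f) \<le> C * Lp_norm p f)"

definition bounded_on_vanishing_morrey ::
  "real \<Rightarrow> real \<Rightarrow> ((real^'n \<Rightarrow> 'a::real_normed_vector) \<Rightarrow> (real^'n \<Rightarrow> 'b::real_normed_vector))
    \<Rightarrow> bool" where
  "bounded_on_vanishing_morrey p lam T \<longleftrightarrow>
     (\<exists>C. \<forall>f\<in>vanishing_morrey_space p lam.
        T f \<in> vanishing_morrey_space p lam \<and> morrey_norm p lam (T f) \<le> C * morrey_norm p lam f)"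

text \<open>The maximal functions may be infinite at some points, hence take values in \<open>ennreal\<close>.\<close>

definition maximal_function :: "(real^'n \<Rightarrow> 'a::real_normed_vector) \<Rightarrow> real^'n \<Rightarrow> ennreal" where
  "maximal_function f x =
     (SUP t\<in>{0<..}. (\<integral>\<^sup>+y\<in>ball x t. ennreal (norm (f y)) \<partial>lebesgue) / emeasure lebesgue (ball x t))"

definition ball_mean ::
  "(real^'n \<Rightarrow> 'a::{banach,second_countable_topology}) \<Rightarrow> real^'n \<Rightarrow> real \<Rightarrow> 'a" where
  "ball_mean f x t = (1 / measure lebesgue (ball x t)) *\<^sub>R (LINT y:ball x t|lebesgue. f y)"

definition sharp_maximal_function ::
  "(real^'n \<Rightarrow> 'a::{banach,second_countable_topology}) \<Rightarrow> real^'n \<Rightarrow> ennreal" where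
  "sharp_maximal_function f x =
     (SUP t\<in>{0<..}. (\<integral>\<^sup>+y\<in>ball x t. ennreal (norm (f y - ball_mean f x t)) \<partial>lebesgue)
                      / emeasure lebesgue (ball x t))"

definition hardy_operator ::
  "(real^'n \<Rightarrow> 'a::{banach,second_countable_topology}) \<Rightarrow> real^'n \<Rightarrow> 'a" where
  "hardy_operator f x =
     (1 / norm x ^ CARD('n)) *\<^sub>R (LINT y:{y. norm y < norm x}|lebesgue. f y)"

definition dual_hardy_operator ::
  "(real^'n \<Rightarrow> 'a::{banach,second_countable_topology}) \<Rightarrow> real^'n \<Rightarrow> 'a" where
  "dual_hardy_operator f x =
     (LINT y:{y. norm y > norm x}|lebesgue. (1 / norm y ^ CARD('n)) *\<^sub>R f y)"

definition truncated_integral ::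
  "(real^'n \<Rightarrow> real^'n \<Rightarrow> 'a::{real_normed_field,banach,second_countable_topology}) \<Rightarrow> real
    \<Rightarrow> (real^'n \<Rightarrow> 'a) \<Rightarrow> real^'n \<Rightarrow> 'a" where
  "truncated_integral K \<epsilon> f x = (LINT y:{y. norm (x - y) > \<epsilon>}|lebesgue. K x y * f y)"

definition singular_integral ::
  "(real^'n \<Rightarrow> real^'n \<Rightarrow> 'a::{real_normed_field,banach,second_countable_topology})
    \<Rightarrow> (real^'n \<Rightarrow> 'a) \<Rightarrow> real^'n \<Rightarrow> 'a" where
  "singular_integral K f x = Lim (at_right 0) (\<lambda>\<epsilon>. truncated_integral K \<epsilon> f x)"

definition admissible_kernel ::
  "real \<Rightarrow> (real^'n \<Rightarrow> real^'n \<Rightarrow> 'a::{real_normed_field,banach,second_countable_topology})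
    \<Rightarrow> bool" where
  "admissible_kernel p K \<longleftrightarrow>
     (\<lambda>(x, y). K x y) \<in> borel_measurable lebesgue \<and>
     (\<exists>c>0. \<forall>x y. x \<noteq> y \<longrightarrow> norm (K x y) \<le> c / norm (x - y) ^ CARD('n)) \<and>
     (\<forall>f\<in>Lp_space p. AE x in lebesgue.
        \<exists>l. ((\<lambda>\<epsilon>. truncated_integral K \<epsilon> f x) \<longlongrightarrow> l) (at_right 0)) \<and>
     bounded_on_Lp p (singular_integral K)"

end

theory Submission
  imports Defs
begin

text \<open>
  Fix a ball \<open>B = B(x, r)\<close> and split \<open>f\<close> into its restriction to \<open>B(x, 2r)\<close> and the rest. All five operators
  are bounded in \<open>L\<^sup>p\<close>, which handles the first piece, and on \<open>B\<close> they map the second piece to something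
  dominated by \<open>\<integral> |f(z)| / |x - z|^n dz\<close> over \<open>|x - z| \<ge> 2r\<close>. A dyadic decomposition and Hoelder's inequality on balls bound
  this tail by a convergent geometric series, because \<open>lam < n\<close>. Only the Morrey modulars of radii
  \<open>\<ge> r\<close> enter, so the modular of \<open>T f\<close> at radius \<open>r\<close> is at most a constant times the supremum of
  those of \<open>f\<close> at radii \<open>\<ge> r\<close>; this gives the norm bound and the vanishing at infinity together.
\<close>

text \<open>No linearity of \<open>T\<close> is used, since the maximal functions are not linear:
  the near-far criterion asks only for an a.e. bound on the ball by some \<open>g\<close> with
  controlled \<open>p\<close>-th power plus a multiple of the tail, which is one constant on that
  ball. A Morrey function need not lie in \<open>L^p\<close> or \<open>L^1\<close> globally, so that
  each operator makes sense on \<open>f\<close> is itself something to prove. Estimates therefore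
  run in \<open>ennreal\<close>, and finiteness is read off at the end. For \<open>S\<close> the
  limit is assumed to exist on \<open>L^p\<close> only; it carries over because truncation at a
  small radius does not touch the far part of \<open>f\<close>. The \<open>L^p\<close> bounds have
  different origins: Vitali covering and layer cake for \<open>M\<close>, pointwise domination by
  \<open>M\<close> for the sharp maximal function and \<open>H\<close>, a Schur test for the dual
  Hardy operator, the hypothesis for \<open>S\<close>. Hoelder's inequality appears in the form of
  Young's inequality with a free parameter.\<close>

section \<open>Product measures built from the completed Lebesgue measure\<close>

lemma sigma_finite_lebesgue: "sigma_finite_measure (lebesgue :: 'a::euclidean_space measure)"
proof
  obtain A :: "'a set set" where A: "countable A" "A \<subseteq> sets lborel" "\<Union>A = space lborel"
      "\<forall>a\<in>A. emeasure lborel a \<noteq> \<infinity>"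
    using lborel.sigma_finite_countable by blast
  show "\<exists>A::'a set set. countable A \<and> A \<subseteq> sets lebesgue \<and> \<Union>A = space lebesgue \<and> (\<forall>a\<in>A. emeasure lebesgue a \<noteq> \<infinity>)"
    using A by (intro exI[of _ A]) (auto simp: subset_iff)
qed

interpretation lebesgue: sigma_finite_measure "lebesgue :: 'a::euclidean_space measure"
  by (rule sigma_finite_lebesgue)

text \<open>Two kinds of interchange occur: \<open>lebesgue_pair\<close> swaps two points of space,
  \<open>lborel_lebesgue_pair\<close> swaps a level in the layer-cake formula with a point.\<close>

interpretation lebesgue_pair: pair_sigma_finite "lebesgue :: 'a::euclidean_space measure" "lebesgue :: 'b::euclidean_space measure"
  by unfold_locales

interpretation lborel_lebesgue_pair: pair_sigma_finite "lborel :: 'a::euclidean_space measure" "lebesgue :: 'b::euclidean_space measure"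
  by unfold_locales

lemma ident_borel_measurable_lebesgue[measurable]:
  "(\<lambda>x::'a::euclidean_space. x) \<in> borel_measurable lebesgue"
  by (intro measurable_completion) simp

lemma ball_sets_lebesgue[measurable]: "ball (x::'a::euclidean_space) r \<in> sets lebesgue"
  by simp

lemma emeasure_lebesgue_ball:
  fixes x :: "real^'n"
  assumes "0 \<le> r"
  shows "emeasure lebesgue (ball x r) = ennreal (unit_ball_vol (real CARD('n)) * r ^ CARD('n))"
  using emeasure_ball[OF assms, of x] by simp

section \<open>Young's inequality and dyadic sums of power weights\<close>

text \<open>Where \<open>h x \<le> m\<close> the first term suffices; where \<open>h x > m\<close>,
  the factor \<open>h x powr (1 - p)\<close> is at most \<open>m powr (1 - p)\<close>. Choosing
  \<open>m\<close> as the \<open>p\<close>-mean of \<open>h\<close> for the weight \<open>w\<close>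
  makes both terms equal and gives Hoelder's inequality up to a factor 2.\<close>

lemma nn_integral_le_Young:
  fixes h :: "'a \<Rightarrow> real"
  assumes [measurable]: "h \<in> borel_measurable M" "w \<in> borel_measurable M"
    and h: "\<And>x. 0 \<le> h x" and "0 < m" "1 < p"
  shows "(\<integral>\<^sup>+x. w x * ennreal (h x) \<partial>M)
    \<le> ennreal m * (\<integral>\<^sup>+x. w x \<partial>M) + ennreal (m powr (1 - p)) * (\<integral>\<^sup>+x. w x * ennreal (h x powr p) \<partial>M)"
proof -
  have *: "h x \<le> m + m powr (1 - p) * h x powr p" for x
  proof (cases "h x \<le> m")
    case True
    moreover have "0 \<le> m powr (1 - p) * h x powr p" by simp
    ultimately show ?thesis by linarith
  next
    case False
    then have "h x powr (1 - p) \<le> m powr (1 - p)"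
      using \<open>0 < m\<close> \<open>1 < p\<close> by (intro powr_mono2') auto
    then have "h x powr (1 - p) * h x powr p \<le> m powr (1 - p) * h x powr p"
      by (intro mult_right_mono) auto
    then show ?thesis using False assms by (simp add: powr_add[symmetric])
  qed
  have "(\<integral>\<^sup>+x. w x * ennreal (h x) \<partial>M)
    \<le> (\<integral>\<^sup>+x. ennreal m * w x + ennreal (m powr (1 - p)) * (w x * ennreal (h x powr p)) \<partial>M)"
  proof (intro nn_integral_mono)
    fix x
    have "w x * ennreal (h x) \<le> w x * (ennreal m + ennreal (m powr (1 - p)) * ennreal (h x powr p))"
      using * [of x] \<open>0 < m\<close> by (intro mult_left_mono) (auto simp: ennreal_mult[symmetric] ennreal_plus[symmetric] simp del: ennreal_plus)
    then show "w x * ennreal (h x) \<le> ennreal m * w x + ennreal (m powr (1 - p)) * (w x * ennreal (h x powr p))"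
      by (simp add: algebra_simps)
  qed
  also have "\<dots> = ennreal m * (\<integral>\<^sup>+x. w x \<partial>M) + ennreal (m powr (1 - p)) * (\<integral>\<^sup>+x. w x * ennreal (h x powr p) \<partial>M)"
    by (simp add: nn_integral_add nn_integral_cmult)
  finally show ?thesis .
qed

text \<open>\<open>k\<close> is the predecessor of the least exponent with
  \<open>s / R < 2 ^ k\<close>; \<open>R \<le> s\<close> makes that exponent positive.\<close>

lemma dyadic_scale_above:
  fixes s R :: real
  assumes "0 < R" "R \<le> s"
  obtains k :: nat where "2 ^ k * R \<le> s" "s < 2 ^ (k + 1) * R"
proof -
  obtain k0 :: nat where "s / R < 2 ^ k0" using real_arch_pow[of 2 "s / R"] by auto
  define k where "k = (LEAST k. s / R < 2 ^ k)"
  have k: "s / R < 2 ^ k" unfolding k_def by (rule LeastI) fact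
  have "k \<noteq> 0" using k assms by (intro notI) (auto simp: field_simps)
  then obtain j where j: "k = Suc j" using not0_implies_Suc by blast
  have "\<not> s / R < 2 ^ j" using not_less_Least[of j "\<lambda>k. s / R < 2 ^ k"] j k_def by auto
  then show ?thesis using k j assms by (intro that[of j]) (auto simp: field_simps)
qed

lemma le_suminf_ennreal: "f k \<le> (\<Sum>k. f k)" for f :: "nat \<Rightarrow> ennreal"
  using sum_le_suminf[OF summableI, of "{k}" f] by simp

text \<open>On the shell between radii \<open>2 ^ k * R\<close> and \<open>2 ^ (k + 1) * R\<close>
  the weight is at most its value at the inner radius. The shell is then enlarged to the full ball,
  because Morrey modulars control integrals over balls.\<close>

lemma nn_integral_dyadic_tail:
  fixes x :: "real^'n"
  assumes [measurable]: "F \<in> borel_measurable lebesgue" and "0 < R" "0 \<le> a"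
  shows "(\<integral>\<^sup>+z. indicator {z. R \<le> dist x z} z * (ennreal (dist x z powr - a) * F z) \<partial>lebesgue)
    \<le> (\<Sum>k. ennreal ((2 ^ k * R) powr - a) * (\<integral>\<^sup>+z\<in>ball x (2 ^ (k + 1) * R). F z \<partial>lebesgue))"
proof -
  have "(\<integral>\<^sup>+z. indicator {z. R \<le> dist x z} z * (ennreal (dist x z powr - a) * F z) \<partial>lebesgue)
    \<le> (\<integral>\<^sup>+z. (\<Sum>k. ennreal ((2 ^ k * R) powr - a) * (F z * indicator (ball x (2 ^ (k + 1) * R)) z)) \<partial>lebesgue)"
  proof (intro nn_integral_mono)
    fix z
    let ?t = "\<lambda>k. ennreal ((2 ^ k * R) powr - a) * (F z * indicator (ball x (2 ^ (k + 1) * R)) z)"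
    show "indicator {z. R \<le> dist x z} z * (ennreal (dist x z powr - a) * F z) \<le> (\<Sum>k. ?t k)"
    proof (cases "R \<le> dist x z")
      case True
      obtain k :: nat where k: "2 ^ k * R \<le> dist x z" "dist x z < 2 ^ (k + 1) * R"
        using dyadic_scale_above[OF \<open>0 < R\<close> True] .
      have "ennreal (dist x z powr - a) * F z \<le> ?t k"
      proof -
        have "dist x z powr - a \<le> (2 ^ k * R) powr - a"
          using k \<open>0 < R\<close> \<open>0 \<le> a\<close> by (intro powr_mono2') auto
        then show ?thesis using k by (auto intro!: mult_right_mono ennreal_leI)
      qed
      also have "\<dots> \<le> (\<Sum>k. ?t k)"
        by (rule le_suminf_ennreal)
      finally show ?thesis using True by simp
    qed simp
  qed
  also have "\<dots> = (\<Sum>k. ennreal ((2 ^ k * R) powr - a) * (\<integral>\<^sup>+z\<in>ball x (2 ^ (k + 1) * R). F z \<partial>lebesgue))"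
    by (subst nn_integral_suminf) (auto intro!: suminf_cong nn_integral_cmult)
  finally show ?thesis .
qed

lemma suminf_ennreal_geometric:
  fixes c q :: real
  assumes "0 \<le> c" "0 \<le> q" "q < 1"
  shows "(\<Sum>k. ennreal (c * q ^ k)) = ennreal (c / (1 - q))"
proof -
  have "(\<lambda>k. c * q ^ k) sums (c * (1 / (1 - q)))"
    using assms by (intro sums_mult geometric_sums) auto
  then show ?thesis using assms by (intro suminf_ennreal_eq) auto
qed

lemma powr_two_power: "((2::real) ^ k) powr a = (2 powr a) ^ k"
  by (simp add: powr_realpow[symmetric] powr_powr mult.commute)

text \<open>Dyadic shells shrinking to the origin: the one of outer radius \<open>s / 2 ^ k\<close>
  contributes a multiple of \<open>q ^ k\<close> with \<open>q = 2 powr (c - n)\<close>, and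
  \<open>c < n\<close> makes this summable. At \<open>z = 0\<close> the integrand is 0 by the
  convention \<open>0 powr a = 0\<close>.\<close>

lemma nn_integral_ball_powr_le:
  fixes c :: real
  assumes "0 \<le> c" "c < real CARD('n::finite)"
  shows "\<exists>C\<ge>0. \<forall>s\<ge>0. (\<integral>\<^sup>+z::real^'n\<in>ball 0 s. ennreal (norm z powr - c) \<partial>lebesgue)
        \<le> ennreal (C * s powr (real CARD('n) - c))"
proof -
  let ?n = "real CARD('n)" and ?V = "unit_ball_vol (real CARD('n))"
  define q where "q = (2::real) powr (c - ?n)"
  have q: "0 \<le> q" "q < 1" using assms by (auto simp: q_def powr_less_one)
  define C where "C = 2 powr c * ?V / (1 - q)"
  have "0 \<le> C" using q by (auto simp: C_def)
  moreover have "(\<integral>\<^sup>+z::real^'n\<in>ball 0 s. ennreal (norm z powr - c) \<partial>lebesgue)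
        \<le> ennreal (C * s powr (?n - c))" if "0 \<le> s" for s
  proof (cases "s = 0")
    case False
    with that have s: "0 < s" by simp
    have "(\<integral>\<^sup>+z::real^'n\<in>ball 0 s. ennreal (norm z powr - c) \<partial>lebesgue)
      \<le> (\<integral>\<^sup>+(z::real^'n). (\<Sum>k. ennreal ((s / 2 ^ (k + 1)) powr - c) * indicator (ball 0 (s / 2 ^ k)) z) \<partial>lebesgue)"
    proof (intro nn_integral_mono)
      fix z :: "real^'n"
      let ?t = "\<lambda>k. ennreal ((s / 2 ^ (k + 1)) powr - c) * indicator (ball 0 (s / 2 ^ k)) z"
      show "ennreal (norm z powr - c) * indicator (ball 0 s) z \<le> (\<Sum>k. ?t k)"
      proof (cases "0 < norm z \<and> norm z < s")
        case True
        have "1 \<le> s / norm z" using True by auto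
        from dyadic_scale_above[of 1, OF _ this] obtain k :: nat where k: "2 ^ k \<le> s / norm z" "s / norm z < 2 ^ (k + 1)"
          by auto
        \<comment> \<open>The scale gives only \<open>norm z \<le> s / 2 ^ k\<close>. On equality
          the open ball of that radius misses \<open>z\<close>, and the next larger shell, of index
          \<open>k - 1\<close>, takes over; \<open>norm z < s\<close> excludes \<open>k = 0\<close>
          there.\<close>
        define j where "j = (if norm z < s / 2 ^ k then k else k - 1)"
        have "norm z \<le> s / 2 ^ k" "s / 2 ^ (k + 1) < norm z"
          using k True by (auto simp: field_simps)
        moreover have "k \<noteq> 0" if "\<not> norm z < s / 2 ^ k" using that True by (cases k) auto
        ultimately have "norm z < s / 2 ^ j" "s / 2 ^ (j + 1) \<le> norm z"
          using s by (auto simp: j_def not_less field_simps split: if_splits; cases k; simp add: field_simps)+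
        moreover from this have "norm z powr - c \<le> (s / 2 ^ (j + 1)) powr - c"
          using assms s by (intro powr_mono2') auto
        ultimately have "ennreal (norm z powr - c) \<le> ?t j"
          by (auto intro!: ennreal_leI)
        also have "\<dots> \<le> (\<Sum>k. ?t k)"
          by (rule le_suminf_ennreal)
        finally show ?thesis using True by simp
      qed (auto split: split_indicator)
    qed
    also have "\<dots> = (\<Sum>k. ennreal ((s / 2 ^ (k + 1)) powr - c) * emeasure lebesgue (ball (0::real^'n) (s / 2 ^ k)))"
      by (simp add: nn_integral_suminf nn_integral_cmult del: emeasure_completion)
    also have "\<dots> = (\<Sum>k. ennreal ((2 powr c * ?V * s powr (?n - c)) * q ^ k))"
    proof (intro suminf_cong)
      fix k
      have "(s / 2 ^ (k + 1)) powr - c * (s / 2 ^ k) powr ?n = 2 powr c * s powr (?n - c) * q ^ k"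
        using s by (simp add: q_def powr_divide powr_mult powr_minus powr_diff powr_two_power field_simps power_mult_distrib power_divide)
      then have *: "(s / 2 ^ (k + 1)) powr - c * (?V * (s / 2 ^ k) ^ CARD('n)) = (2 powr c * ?V * s powr (?n - c)) * q ^ k"
        using s by (simp add: powr_realpow[symmetric] mult_ac)
      show "ennreal ((s / 2 ^ (k + 1)) powr - c) * emeasure lebesgue (ball (0::real^'n) (s / 2 ^ k))
          = ennreal ((2 powr c * ?V * s powr (?n - c)) * q ^ k)"
        using s by (simp only: *[symmetric], subst emeasure_lebesgue_ball) (auto simp: ennreal_mult)
    qed
    also have "\<dots> = ennreal ((2 powr c * ?V * s powr (?n - c)) / (1 - q))"
      using q by (intro suminf_ennreal_geometric) auto
    finally show ?thesis by (simp add: C_def)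
  qed simp
  ultimately show ?thesis by blast
qed

text \<open>The counterpart at infinity: decay by \<open>b > 0\<close> beyond the critical exponent
  gives shells with ratio \<open>2 powr - b\<close>. It will measure the total mass of the weight in
  the Schur test.\<close>

lemma nn_integral_tail_powr_le:
  fixes b :: real
  assumes "0 < b"
  shows "\<exists>C\<ge>0. \<forall>s>0. (\<integral>\<^sup>+z. indicator {z::real^'n. s \<le> norm z} z * ennreal (norm z powr - (real CARD('n) + b)) \<partial>lebesgue)
        \<le> ennreal (C * s powr - b)"
proof -
  let ?n = "real CARD('n)" and ?V = "unit_ball_vol (real CARD('n))"
  define q where "q = (2::real) powr - b"
  have q: "0 \<le> q" "q < 1" using assms by (auto simp: q_def powr_less_one)
  define C where "C = 2 powr ?n * ?V / (1 - q)"
  have "0 \<le> C" using q by (auto simp: C_def)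
  moreover have "(\<integral>\<^sup>+z. indicator {z::real^'n. s \<le> norm z} z * ennreal (norm z powr - (?n + b)) \<partial>lebesgue)
        \<le> ennreal (C * s powr - b)" if s: "0 < s" for s
  proof -
    have "(\<integral>\<^sup>+z. indicator {z::real^'n. s \<le> norm z} z * ennreal (norm z powr - (?n + b)) \<partial>lebesgue)
       \<le> (\<Sum>k. ennreal ((2 ^ k * s) powr - (?n + b)) * (\<integral>\<^sup>+z\<in>ball (0::real^'n) (2 ^ (k + 1) * s). 1 \<partial>lebesgue))"
      using nn_integral_dyadic_tail[of "\<lambda>_. 1" s "?n + b" "0::real^'n"] s assms by simp
    also have "\<dots> = (\<Sum>k. ennreal ((2 powr ?n * ?V * s powr - b) * q ^ k))"
    proof (intro suminf_cong)
      fix k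
      have "(2 ^ k * s) powr - (?n + b) * (2 ^ (k + 1) * s) powr ?n = 2 powr ?n * s powr - b * q ^ k"
        using s by (simp add: q_def powr_mult powr_minus powr_diff powr_add powr_two_power field_simps power_mult_distrib power_divide)
      then have *: "(2 ^ k * s) powr - (?n + b) * (?V * (2 ^ (k + 1) * s) ^ CARD('n)) = (2 powr ?n * ?V * s powr - b) * q ^ k"
        using s by (simp add: powr_realpow[symmetric] mult_ac)
      have "(\<integral>\<^sup>+z\<in>ball (0::real^'n) (2 ^ (k + 1) * s). 1 \<partial>lebesgue) = ennreal (?V * (2 ^ (k + 1) * s) ^ CARD('n))"
        using s by (simp add: emeasure_lebesgue_ball del: emeasure_completion)
      then show "ennreal ((2 ^ k * s) powr - (?n + b)) * (\<integral>\<^sup>+z\<in>ball (0::real^'n) (2 ^ (k + 1) * s). 1 \<partial>lebesgue)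
          = ennreal ((2 powr ?n * ?V * s powr - b) * q ^ k)"
        using s by (simp only: *[symmetric]) (simp add: ennreal_mult)
    qed
    also have "\<dots> = ennreal ((2 powr ?n * ?V * s powr - b) / (1 - q))"
      using q by (intro suminf_ennreal_geometric) auto
    finally show ?thesis by (simp add: C_def)
  qed
  ultimately show ?thesis by blast
qed

section \<open>Maximal functions\<close>

lemma AE_lebesgue_neq: "AE x in lebesgue. x \<noteq> (a::'a::euclidean_space)"
proof -
  have "{a} \<in> null_sets lebesgue" by (simp add: negligible_iff_null_sets[symmetric])
  then show ?thesis by (rule AE_I') auto
qed

lemma AE_notin_sphere: "AE y in lebesgue. dist (x::'a::euclidean_space) y \<noteq> t"
proof -
  have "sphere x t \<in> null_sets lebesgue"
    using negligible_sphere[of x t] by (simp add: negligible_iff_null_sets)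
  then show ?thesis
    by (rule AE_I') auto
qed

text \<open>Dominated convergence along a sequence of centres: indicators of the moving balls
  converge off the limiting sphere, which is null, and centres within distance 1 of
  \<open>x0\<close> keep every ball inside \<open>cball x0 (1 + t)\<close>. The integrand may depend
  on the centre because the sharp maximal function subtracts the mean over the moving ball.\<close>

lemma isCont_ball_integral:
  fixes g :: "real^'n \<Rightarrow> real^'n \<Rightarrow> 'b::{banach,second_countable_topology}"
  assumes meas[measurable]: "\<And>x. g x \<in> borel_measurable lebesgue"
    and cont: "\<And>y. isCont (\<lambda>x. g x y) x0"
    and bound: "\<And>x y. dist x0 x < 1 \<Longrightarrow> norm (g x y) \<le> w y"
    and w: "set_integrable lebesgue (cball x0 (1 + t)) w"
  shows "isCont (\<lambda>x. LINT y:ball x t|lebesgue. g x y) x0"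
  unfolding continuous_at_sequentially
proof (intro allI impI)
  fix u :: "nat \<Rightarrow> real^'n" assume u: "u \<longlonglongrightarrow> x0"
  then obtain N where N: "dist x0 (u n) < 1" if "n \<ge> N" for n
    using metric_LIMSEQ_D[OF u zero_less_one] by (metis dist_commute)
  define v where "v n = u (n + N)" for n
  have v: "v \<longlonglongrightarrow> x0" unfolding v_def using u by (rule LIMSEQ_ignore_initial_segment)
  have v1: "dist x0 (v n) < 1" for n using N by (simp add: v_def)
  have "(\<lambda>n. LINT y|lebesgue. indicator (ball (v n) t) y *\<^sub>R g (v n) y)
      \<longlonglongrightarrow> (LINT y|lebesgue. indicator (ball x0 t) y *\<^sub>R g x0 y)"
  proof (rule integral_dominated_convergence[where w="\<lambda>y. indicator (cball x0 (1 + t)) y *\<^sub>R w y"])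
    show "integrable lebesgue (\<lambda>y. indicator (cball x0 (1 + t)) y *\<^sub>R w y)"
      using w by (simp add: set_integrable_def)
    show "AE y in lebesgue. (\<lambda>n. indicator (ball (v n) t) y *\<^sub>R g (v n) y) \<longlonglongrightarrow> indicator (ball x0 t) y *\<^sub>R g x0 y"
      using AE_notin_sphere[of x0 t]
    proof (rule AE_mp, intro AE_I2 impI)
      fix y assume y: "dist x0 y \<noteq> t"
      have d: "(\<lambda>n. dist (v n) y) \<longlonglongrightarrow> dist x0 y" using v by (intro tendsto_intros)
      have "\<forall>\<^sub>F n in sequentially. (dist (v n) y < t) = (dist x0 y < t)"
      proof (cases "dist x0 y < t")
        case True
        then show ?thesis using order_tendstoD(2)[OF d, of t] by (auto elim: eventually_mono)
      next
        case False
        then show ?thesis using order_tendstoD(1)[OF d, of t] y by (auto elim!: eventually_mono)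
      qed
      then have "\<forall>\<^sub>F n in sequentially. indicator (ball x0 t) y *\<^sub>R g (v n) y = indicator (ball (v n) t) y *\<^sub>R g (v n) y"
        by (auto elim!: eventually_mono simp: indicator_def)
      moreover have "(\<lambda>n. indicator (ball x0 t) y *\<^sub>R g (v n) y) \<longlonglongrightarrow> indicator (ball x0 t) y *\<^sub>R g x0 y"
        using isCont_tendsto_compose[OF cont v] by (intro tendsto_intros)
      ultimately show "(\<lambda>n. indicator (ball (v n) t) y *\<^sub>R g (v n) y) \<longlonglongrightarrow> indicator (ball x0 t) y *\<^sub>R g x0 y"
        by (rule Lim_transform_eventually[rotated])
    qed
    show "AE y in lebesgue. norm (indicator (ball (v n) t) y *\<^sub>R g (v n) y) \<le> indicator (cball x0 (1 + t)) y *\<^sub>R w y" for n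
    proof (intro AE_I2)
      fix y
      have "0 \<le> w y" using bound[OF v1[of n], of y] norm_ge_zero order_trans by blast
      moreover have "y \<in> cball x0 (1 + t)" if "y \<in> ball (v n) t"
        using that v1[of n] dist_triangle[of x0 y "v n"] by auto
      ultimately show "norm (indicator (ball (v n) t) y *\<^sub>R g (v n) y) \<le> indicator (cball x0 (1 + t)) y *\<^sub>R w y"
        using bound[OF v1[of n], of y] by (auto simp: indicator_def)
    qed
  qed simp_all
  then have "(\<lambda>n. (\<lambda>x. LINT y:ball x t|lebesgue. g x y) (u (n + N))) \<longlonglongrightarrow> (LINT y:ball x0 t|lebesgue. g x0 y)"
    by (simp add: set_lebesgue_integral_def v_def)
  then show "((\<lambda>x. LINT y:ball x t|lebesgue. g x y) \<circ> u) \<longlonglongrightarrow> (LINT y:ball x0 t|lebesgue. g x0 y)"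
    unfolding comp_def by (rule LIMSEQ_offset)
qed

lemma continuous_on_ball_mean:
  fixes f :: "real^'n \<Rightarrow> 'b::{banach,second_countable_topology}"
  assumes [measurable]: "f \<in> borel_measurable lebesgue" and f: "\<And>A. compact A \<Longrightarrow> set_integrable lebesgue A f"
  shows "continuous_on UNIV (\<lambda>x. ball_mean f x t)"
proof (cases "0 \<le> t")
  case True
  have *: "measure lebesgue (ball x t) = unit_ball_vol (real CARD('n)) * t ^ CARD('n)" for x :: "real^'n"
    using emeasure_lebesgue_ball[OF True, of x] True by (simp add: measure_def)
  have "isCont (\<lambda>x. LINT y:ball x t|lebesgue. f y) x" for x
    by (rule isCont_ball_integral[where w="\<lambda>y. norm (f y)"]) (auto intro!: set_integrable_norm f)
  then show ?thesis unfolding ball_mean_def *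
    by (intro continuous_intros continuous_at_imp_continuous_on) auto
qed (simp add: ball_mean_def ball_empty)

text \<open>Both maximal functions are suprema of continuous functions of the centre, hence lower semicontinuous.\<close>

lemma borel_measurable_SUP_ball_average:
  fixes f :: "real^'n \<Rightarrow> 'b::{banach,second_countable_topology}"
  assumes [measurable]: "f \<in> borel_measurable lebesgue" and f: "\<And>A. compact A \<Longrightarrow> set_integrable lebesgue A f"
    and c: "\<And>t. 0 < t \<Longrightarrow> continuous_on UNIV (c t)"
  shows "(\<lambda>x. SUP t\<in>{0<..}. (\<integral>\<^sup>+y\<in>ball x t. ennreal (norm (f y - c t x)) \<partial>lebesgue) / emeasure lebesgue (ball x t))
    \<in> borel_measurable borel" (is "(\<lambda>x. SUP t\<in>{0<..}. ?F t x) \<in> _")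
proof (rule borel_measurableI_greater)
  fix a
  have "open {x. a < ?F t x}" if t: "0 < t" for t
  proof -
    define L where "L x = (LINT y:ball x t|lebesgue. norm (f y - c t x))" for x
    have int: "set_integrable lebesgue (ball x t) (\<lambda>y. norm (f y - c t x))" for x
    proof (intro set_integrable_norm set_integral_diff)
      show "set_integrable lebesgue (ball x t) f"
        by (rule set_integrable_subset[OF f[of "cball x t"]]) auto
      show "set_integrable lebesgue (ball x t) (\<lambda>y. c t x)"
        by (auto simp: set_integrable_def lmeasurable_iff_integrable[symmetric] intro!: integrable_scaleR_left)
    qed
    have "isCont L x" for x
    proof -
      \<comment> \<open>The subtracted values stay bounded by \<open>B\<close> for centres in a
        compact neighbourhood, which yields a majorant independent of the centre.\<close>
      have "compact (c t ` cball x 1)"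
        using c[OF t] by (intro compact_continuous_image) (auto intro: continuous_on_subset)
      then obtain B where B: "\<And>z. z \<in> cball x 1 \<Longrightarrow> norm (c t z) \<le> B"
        by (meson bounded_iff compact_imp_bounded imageI)
      show ?thesis unfolding L_def
      proof (rule isCont_ball_integral[where w="\<lambda>y. norm (f y) + B"])
        show "isCont (\<lambda>x. norm (f y - c t x)) x" for y
          using c[OF t] by (intro continuous_intros) (simp add: continuous_on_eq_continuous_at)
        show "norm (norm (f y - c t z)) \<le> norm (f y) + B" if "dist x z < 1" for z y
          using norm_triangle_ineq4[of "f y" "c t z"] B[of z] that by auto
        show "set_integrable lebesgue (cball x (1 + t)) (\<lambda>y. norm (f y) + B)"
          by (intro set_integral_add set_integrable_norm f)
            (auto simp: set_integrable_def lmeasurable_iff_integrable[symmetric] intro!: integrable_scaleR_left integrable_mult_left)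
      qed auto
    qed
    moreover have "unit_ball_vol (real CARD('n)) \<noteq> 0"
      using unit_ball_vol_pos[of "real CARD('n)"] by linarith
    ultimately have "continuous_on UNIV (\<lambda>x. ennreal (L x / (unit_ball_vol (real CARD('n)) * t ^ CARD('n))))"
      using t by (intro continuous_on_ennreal continuous_intros continuous_at_imp_continuous_on) auto
    moreover have "?F t x = ennreal (L x / (unit_ball_vol (real CARD('n)) * t ^ CARD('n)))" for x
    proof -
      have "(\<integral>\<^sup>+y\<in>ball x t. ennreal (norm (f y - c t x)) \<partial>lebesgue) = ennreal (L x)"
        using int[of x] unfolding L_def set_lebesgue_integral_def set_integrable_def
        by (subst nn_integral_eq_integral[symmetric])
          (auto intro!: nn_integral_cong simp: ennreal_mult' ennreal_indicator[symmetric] mult.commute)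
      moreover have "0 \<le> L x" by (auto simp: L_def set_lebesgue_integral_def)
      ultimately show ?thesis using t by (simp add: emeasure_lebesgue_ball divide_ennreal del: emeasure_completion)
    qed
    ultimately show ?thesis by (simp add: open_Collect_less continuous_on_const)
  qed
  moreover have "{x \<in> space borel. a < (SUP t\<in>{0<..}. ?F t x)} = (\<Union>t\<in>{0<..}. {x. a < ?F t x})"
    by (auto simp: less_SUP_iff)
  ultimately show "{x \<in> space borel. a < (SUP t\<in>{0<..}. ?F t x)} \<in> sets borel"
    by (auto intro!: borel_open)
qed

lemma borel_measurable_maximal_function:
  fixes f :: "real^'n \<Rightarrow> 'b::{banach,second_countable_topology}"
  assumes "f \<in> borel_measurable lebesgue" "\<And>A. compact A \<Longrightarrow> set_integrable lebesgue A f"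
  shows "maximal_function f \<in> borel_measurable lebesgue"
  unfolding maximal_function_def[abs_def]
  using borel_measurable_SUP_ball_average[OF assms, of "\<lambda>_ _. 0"]
  by (auto intro!: measurable_completion)

lemma borel_measurable_sharp_maximal_function:
  fixes f :: "real^'n \<Rightarrow> 'b::{banach,second_countable_topology}"
  assumes "f \<in> borel_measurable lebesgue" "\<And>A. compact A \<Longrightarrow> set_integrable lebesgue A f"
  shows "sharp_maximal_function f \<in> borel_measurable lebesgue"
  unfolding sharp_maximal_function_def[abs_def]
  using borel_measurable_SUP_ball_average[OF assms, of "\<lambda>t x. ball_mean f x t"] continuous_on_ball_mean[OF assms]
  by (auto intro!: measurable_completion)

section \<open>Weak and strong type bounds for the maximal function\<close>

text \<open>Countably many disjoint balls are selected whose fivefold dilates cover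
  \<open>E\<close>. Disjointness keeps the sum of the integrals of \<open>h\<close> below its total
  integral, and dilation costs \<open>5 ^ n\<close>. For level sets of the maximal function this is
  the weak-type (1,1) bound; \<open>h\<close> is kept general because it will be a truncation of |f|
  that varies with the level.\<close>

lemma Vitali_covering_inequality:
  fixes h :: "real^'n \<Rightarrow> ennreal"
  assumes [measurable]: "h \<in> borel_measurable lebesgue" "E \<in> sets lebesgue" and a: "0 < a"
    and E: "\<And>x. x \<in> E \<Longrightarrow> \<exists>t>0. ennreal a * emeasure lebesgue (ball x t) \<le> (\<integral>\<^sup>+y\<in>ball x t. h y \<partial>lebesgue)"
  shows "ennreal a * emeasure lebesgue E \<le> 5 ^ CARD('n) * (\<integral>\<^sup>+y. h y \<partial>lebesgue)"
proof (cases "(\<integral>\<^sup>+y. h y \<partial>lebesgue) = \<infinity>")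
  case True
  then show ?thesis by (simp add: ennreal_mult_top)
next
  case False
  let ?V = "unit_ball_vol (real CARD('n))"
  obtain I where I: "(\<integral>\<^sup>+y. h y \<partial>lebesgue) = ennreal I" "0 \<le> I"
    using False by (cases "\<integral>\<^sup>+y. h y \<partial>lebesgue") auto
  obtain r where r: "\<And>x. x \<in> E \<Longrightarrow> 0 < r x"
    and rh: "\<And>x. x \<in> E \<Longrightarrow> ennreal a * emeasure lebesgue (ball x (r x)) \<le> (\<integral>\<^sup>+y\<in>ball x (r x). h y \<partial>lebesgue)"
    using E by metis
  \<comment> \<open>The Vitali selection requires bounded radii. The finite integral of
    \<open>h\<close> bounds the \<open>n\<close>-th power of the radius, hence the radius itself
    once it exceeds 1.\<close>
  have rB: "r x \<le> max 1 (I / (a * ?V))" if "x \<in> E" for x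
  proof (cases "r x \<le> 1")
    case False
    have "(\<integral>\<^sup>+y\<in>ball x (r x). h y \<partial>lebesgue) \<le> ennreal I"
      unfolding I(1)[symmetric] by (intro nn_integral_mono) (auto split: split_indicator)
    then have "ennreal (a * (?V * r x ^ CARD('n))) \<le> ennreal I"
      using rh[OF that] r[OF that] a
      by (auto simp: emeasure_lebesgue_ball ennreal_mult[symmetric] simp del: emeasure_completion)
    then have "a * (?V * r x ^ CARD('n)) \<le> I" using I(2) by simp
    then have "r x ^ CARD('n) \<le> I / (a * ?V)" using a by (simp add: field_simps)
    moreover have "r x \<le> r x ^ CARD('n)" using False by (intro self_le_power) auto
    ultimately show ?thesis by linarith
  qed simp
  obtain C where C: "countable C" "C \<subseteq> E" "pairwise (\<lambda>i j. disjnt (ball i (r i)) (ball j (r j))) C"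
      "E \<subseteq> (\<Union>i\<in>C. ball i (5 * r i))"
    by (rule Vitali_covering_lemma_balls[where S=E and K=E and a="\<lambda>x. x" and r=r and B="max 1 (I / (a * ?V))"])
      (use r rB in auto)
  define D where "D = to_nat_on C ` C"
  \<comment> \<open>\<open>X s n\<close> is the \<open>n\<close>-th selected ball dilated by
    \<open>s\<close>, and empty when \<open>n\<close> codes no ball, so finite and infinite
    selections are treated alike: \<open>X 1\<close> is disjoint and \<open>X 5\<close> covers
    \<open>E\<close>.\<close>
  define X where "X s n = (if n \<in> D then ball (from_nat_into C n) (s * r (from_nat_into C n)) else {})" for s :: real and n
  have inC: "from_nat_into C n \<in> C" if "n \<in> D" for n using that C(1) by (auto simp: D_def)
  have Xm[measurable]: "X s n \<in> sets lebesgue" for s n by (auto simp: X_def)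
  have disj: "disjoint_family (X 1)"
    unfolding disjoint_family_on_def
  proof (intro ballI impI)
    fix m n :: nat assume "m \<noteq> n"
    then have "from_nat_into C m \<noteq> from_nat_into C n" if "m \<in> D" "n \<in> D"
      using that C(1) by (auto simp: D_def)
    then show "X 1 m \<inter> X 1 n = {}"
      using C(3) inC by (auto simp: X_def pairwise_def disjnt_def)
  qed
  have cov: "E \<subseteq> (\<Union>n. X 5 n)"
  proof
    fix x assume "x \<in> E"
    then obtain i where "i \<in> C" "x \<in> ball i (5 * r i)" using C(4) by auto
    then have "x \<in> X 5 (to_nat_on C i)" using C(1) by (auto simp: X_def D_def)
    then show "x \<in> (\<Union>n. X 5 n)" by blast
  qed
  have scale: "emeasure lebesgue (X 5 n) = 5 ^ CARD('n) * emeasure lebesgue (X 1 n)" for n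
  proof (cases "n \<in> D")
    case True
    then have "0 < r (from_nat_into C n)" using inC C(2) r by blast
    then show ?thesis using True
      by (simp add: X_def emeasure_lebesgue_ball power_mult_distrib ennreal_mult ennreal_power[symmetric] mult_ac del: emeasure_completion)
  qed (simp add: X_def)
  have avg: "ennreal a * emeasure lebesgue (X 1 n) \<le> (\<integral>\<^sup>+y. h y * indicator (X 1 n) y \<partial>lebesgue)" for n
    using rh inC C(2) by (auto simp: X_def simp del: emeasure_completion)
  have "ennreal a * emeasure lebesgue E \<le> ennreal a * (\<Sum>n. emeasure lebesgue (X 5 n))"
    using cov by (intro mult_left_mono order_trans[OF emeasure_mono emeasure_subadditive_countably]) auto
  also have "\<dots> = 5 ^ CARD('n) * (\<Sum>n. ennreal a * emeasure lebesgue (X 1 n))"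
    by (simp add: scale mult_ac del: emeasure_completion)
  also have "\<dots> \<le> 5 ^ CARD('n) * (\<Sum>n. \<integral>\<^sup>+y. h y * indicator (X 1 n) y \<partial>lebesgue)"
    by (intro mult_left_mono suminf_le avg) auto
  also have "(\<Sum>n. \<integral>\<^sup>+y. h y * indicator (X 1 n) y \<partial>lebesgue) = (\<integral>\<^sup>+y. (\<Sum>n. h y * indicator (X 1 n) y) \<partial>lebesgue)"
    by (subst nn_integral_suminf) auto
  also have "\<dots> \<le> (\<integral>\<^sup>+y. h y \<partial>lebesgue)"
    by (intro nn_integral_mono) (simp add: suminf_indicator[OF disj] split: split_indicator)
  finally show ?thesis by (simp add: mult_left_mono)
qed


lemma nn_integral_powr_from_0:
  fixes c q :: real
  assumes "0 \<le> c" "0 < q"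
  shows "(\<integral>\<^sup>+t. ennreal (t powr (q - 1)) * indicator {0..c} t \<partial>lborel) = ennreal (c powr q / q)"
  using nn_integral_has_integral_lebesgue'[OF _ has_integral_powr_from_0[of "q - 1" c]] assms by simp

text \<open>Layer-cake integration of the weak-type bound for \<open>f\<close> restricted to the set where \<open>|f| \<ge> t / 2\<close>;
  only there can \<open>f\<close> contribute to the level set of the maximal function at height \<open>t\<close>.\<close>

lemma nn_integral_le_maximal_function:
  fixes f :: "real^'n \<Rightarrow> 'b::{banach,second_countable_topology}" and u :: "real^'n \<Rightarrow> real"
  assumes [measurable]: "f \<in> borel_measurable lebesgue" "u \<in> borel_measurable lebesgue"
    and u: "\<And>x. 0 \<le> u x" "\<And>x. ennreal (u x) \<le> maximal_function f x" and p: "1 < p"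
  shows "(\<integral>\<^sup>+x. ennreal (u x powr p) \<partial>lebesgue)
    \<le> ennreal (4 * p * 5 ^ CARD('n) * 2 powr (p - 1) / (p - 1)) * (\<integral>\<^sup>+x. ennreal (norm (f x) powr p) \<partial>lebesgue)"
proof -
  let ?h = "\<lambda>t y. ennreal (norm (f y)) * indicator {y. t / 2 \<le> norm (f y)} y"
  have Et[measurable]: "{x. t \<le> u x} \<in> sets lebesgue" for t
    using measurable_sets[OF assms(2), of "{t..}"] by (simp add: vimage_def)
  have level: "ennreal t * emeasure lebesgue {x. t \<le> u x}
      \<le> 4 * 5 ^ CARD('n) * (\<integral>\<^sup>+y. ?h t y \<partial>lebesgue)" if t: "0 < t" for t
  proof -
    \<comment> \<open>Points with |f| < t/2 contribute at most t/2 to an average, so an average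
      above 3t/4 leaves at least t/4 to the truncated function. Lowering t to 3t/4 gives a strict
      inequality, which is what makes some single ball exceed it.\<close>
    have "ennreal (t / 4) * emeasure lebesgue {x. t \<le> u x} \<le> 5 ^ CARD('n) * (\<integral>\<^sup>+y. ?h t y \<partial>lebesgue)"
    proof (rule Vitali_covering_inequality)
      fix x assume "x \<in> {x. t \<le> u x}"
      then have "ennreal (3 * t / 4) < maximal_function f x"
        using u(2)[of x] t by (intro less_le_trans[OF _ u(2)]) (auto simp: ennreal_less_iff)
      then obtain s where s: "0 < s"
        "ennreal (3 * t / 4) < (\<integral>\<^sup>+y\<in>ball x s. ennreal (norm (f y)) \<partial>lebesgue) / emeasure lebesgue (ball x s)"
        by (auto simp: maximal_function_def less_SUP_iff simp del: emeasure_completion)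
      define v where "v = unit_ball_vol (real CARD('n)) * s ^ CARD('n)"
      have v: "0 < v" "emeasure lebesgue (ball x s) = ennreal v"
        using s(1) by (auto simp: v_def emeasure_lebesgue_ball simp del: emeasure_completion)
      have 1: "ennreal (3 * t / 4) * ennreal v \<le> (\<integral>\<^sup>+y\<in>ball x s. ennreal (norm (f y)) \<partial>lebesgue)"
      proof (cases "(\<integral>\<^sup>+y\<in>ball x s. ennreal (norm (f y)) \<partial>lebesgue)")
        case (real I)
        then show ?thesis using s(2) v t
          by (simp add: divide_ennreal ennreal_mult[symmetric] ennreal_less_iff field_simps)
      qed simp
      also have "\<dots> \<le> (\<integral>\<^sup>+y. ennreal (t / 2) * indicator (ball x s) y + ?h t y * indicator (ball x s) y \<partial>lebesgue)"
        by (intro nn_integral_mono) (auto split: split_indicator intro!: ennreal_leI)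
      also have "\<dots> = ennreal (t / 2) * ennreal v + (\<integral>\<^sup>+y\<in>ball x s. ?h t y \<partial>lebesgue)"
        by (subst nn_integral_add) (auto simp: nn_integral_cmult v simp del: emeasure_completion)
      finally have 2: "ennreal (3 * t / 4) * ennreal v \<le> ennreal (t / 2) * ennreal v + (\<integral>\<^sup>+y\<in>ball x s. ?h t y \<partial>lebesgue)" .
      have "ennreal (t / 4) * ennreal v \<le> (\<integral>\<^sup>+y\<in>ball x s. ?h t y \<partial>lebesgue)"
      proof (cases "(\<integral>\<^sup>+y\<in>ball x s. ?h t y \<partial>lebesgue)")
        case (real I)
        have "3 * t / 4 * v \<le> t / 2 * v + I"
          using 2 t v real by (simp add: ennreal_mult[symmetric] ennreal_plus[symmetric] del: ennreal_plus)
        then show ?thesis unfolding real using t v by (auto simp: ennreal_mult[symmetric] intro!: ennreal_leI)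
      qed simp
      then show "\<exists>s>0. ennreal (t / 4) * emeasure lebesgue (ball x s) \<le> (\<integral>\<^sup>+y\<in>ball x s. ?h t y \<partial>lebesgue)"
        using s(1) v by auto
    qed (use t Et in auto)
    then have "4 * (ennreal (t / 4) * emeasure lebesgue {x. t \<le> u x}) \<le> 4 * (5 ^ CARD('n) * (\<integral>\<^sup>+y. ?h t y \<partial>lebesgue))"
      by (rule mult_left_mono) simp
    moreover have "4 * ennreal (t / 4) = ennreal t"
      using t by (simp add: ennreal_mult'[symmetric] flip: ennreal_numeral)
    ultimately show ?thesis by (simp only: mult.assoc[symmetric])
  qed
  have "(\<integral>\<^sup>+x. ennreal (u x powr p) \<partial>lebesgue)
      = (\<integral>\<^sup>+x. (\<integral>\<^sup>+t. ennreal (p * t powr (p - 1)) * indicator {0..u x} t \<partial>lborel) \<partial>lebesgue)"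
  proof (intro nn_integral_cong)
    fix x
    have "(\<integral>\<^sup>+t. ennreal (p * t powr (p - 1)) * indicator {0..u x} t \<partial>lborel)
      = ennreal p * (\<integral>\<^sup>+t. ennreal (t powr (p - 1)) * indicator {0..u x} t \<partial>lborel)"
      using p by (subst nn_integral_cmult[symmetric]) (auto simp: ennreal_mult mult_ac)
    also have "\<dots> = ennreal (u x powr p)"
      using p u(1)[of x] by (simp add: nn_integral_powr_from_0 ennreal_mult[symmetric])
    finally show "ennreal (u x powr p) = (\<integral>\<^sup>+t. ennreal (p * t powr (p - 1)) * indicator {0..u x} t \<partial>lborel)" ..
  qed
  \<comment> \<open>Writing the domain as a set of pairs exhibits the joint measurability needed to
    interchange the integrals.\<close>
  also have "\<dots> = (\<integral>\<^sup>+x. (\<integral>\<^sup>+t. ennreal (p * t powr (p - 1)) * indicator {(t, x). 0 \<le> t \<and> t \<le> u x} (t, x) \<partial>lborel) \<partial>lebesgue)"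
    by (intro nn_integral_cong) (auto split: split_indicator)
  also have "\<dots> = (\<integral>\<^sup>+t. (\<integral>\<^sup>+x. ennreal (p * t powr (p - 1)) * indicator {(t, x). 0 \<le> t \<and> t \<le> u x} (t, x) \<partial>lebesgue) \<partial>lborel)"
    by (rule lborel_lebesgue_pair.Fubini') measurable
  \<comment> \<open>The weak-type bound costs one power of \<open>t\<close>. The exponent stays in
    the form \<open>p - 1 - 1\<close> so that, after the second interchange,
    \<open>nn_integral_powr_from_0\<close> applies with \<open>q = p - 1\<close>; this is the source
    of the factor \<open>1 / (p - 1)\<close>.\<close>
  also have "\<dots> \<le> (\<integral>\<^sup>+t. (\<integral>\<^sup>+y. ennreal (4 * 5 ^ CARD('n) * p * t powr (p - 1 - 1)) * (ennreal (norm (f y)) * indicator {(t, y). 0 \<le> t \<and> t \<le> 2 * norm (f y)} (t, y)) \<partial>lebesgue) \<partial>lborel)"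
  proof (rule nn_integral_mono)
    fix t :: real
    show "(\<integral>\<^sup>+x. ennreal (p * t powr (p - 1)) * indicator {(t, x). 0 \<le> t \<and> t \<le> u x} (t, x) \<partial>lebesgue)
      \<le> (\<integral>\<^sup>+y. ennreal (4 * 5 ^ CARD('n) * p * t powr (p - 1 - 1)) * (ennreal (norm (f y)) * indicator {(t, y). 0 \<le> t \<and> t \<le> 2 * norm (f y)} (t, y)) \<partial>lebesgue)"
    proof (cases "0 < t")
      case True
      have "(\<integral>\<^sup>+x. ennreal (p * t powr (p - 1)) * indicator {(t, x). 0 \<le> t \<and> t \<le> u x} (t, x) \<partial>lebesgue)
        = (\<integral>\<^sup>+x. ennreal (p * t powr (p - 1)) * indicator {x. t \<le> u x} x \<partial>lebesgue)"
        using True by (intro nn_integral_cong) (auto split: split_indicator)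
      also have "\<dots> = ennreal (p * t powr (p - 1)) * emeasure lebesgue {x. t \<le> u x}"
        by (rule nn_integral_cmult_indicator) measurable
      also have "\<dots> = ennreal (p * t powr (p - 1 - 1)) * ennreal t * emeasure lebesgue {x. t \<le> u x}"
        using True p by (simp add: ennreal_mult[symmetric] powr_diff power2_eq_square)
      also have "\<dots> \<le> ennreal (p * t powr (p - 1 - 1)) * (4 * 5 ^ CARD('n) * (\<integral>\<^sup>+y. ?h t y \<partial>lebesgue))"
        unfolding mult.assoc by (intro mult_left_mono level[unfolded mult.assoc] True) simp
      also have "\<dots> = ennreal (4 * 5 ^ CARD('n) * p * t powr (p - 1 - 1)) * (\<integral>\<^sup>+y. ?h t y \<partial>lebesgue)"
        using p by (simp add: ennreal_mult' mult_ac flip: ennreal_power ennreal_numeral)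
      also have "\<dots> = (\<integral>\<^sup>+y. ennreal (4 * 5 ^ CARD('n) * p * t powr (p - 1 - 1)) * ?h t y \<partial>lebesgue)"
        by (rule nn_integral_cmult[symmetric]) measurable
      also have "\<dots> = (\<integral>\<^sup>+y. ennreal (4 * 5 ^ CARD('n) * p * t powr (p - 1 - 1)) * (ennreal (norm (f y)) * indicator {(t, y). 0 \<le> t \<and> t \<le> 2 * norm (f y)} (t, y)) \<partial>lebesgue)"
        using True by (intro nn_integral_cong) (auto split: split_indicator)
      finally show ?thesis .
    next
      case False
      then have "(\<lambda>x. ennreal (p * t powr (p - 1)) * indicator {(t, x). 0 \<le> t \<and> t \<le> u x} (t, x)) = (\<lambda>x. 0)"
        by (auto split: split_indicator)
      then show ?thesis by simp
    qed
  qed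
  also have "\<dots> = (\<integral>\<^sup>+y. (\<integral>\<^sup>+t. ennreal (4 * 5 ^ CARD('n) * p * t powr (p - 1 - 1)) * (ennreal (norm (f y)) * indicator {(t, y). 0 \<le> t \<and> t \<le> 2 * norm (f y)} (t, y)) \<partial>lborel) \<partial>lebesgue)"
    by (rule lborel_lebesgue_pair.Fubini'[symmetric]) measurable
  also have "\<dots> = (\<integral>\<^sup>+y. ennreal (4 * p * 5 ^ CARD('n) * 2 powr (p - 1) / (p - 1)) * ennreal (norm (f y) powr p) \<partial>lebesgue)"
  proof (intro nn_integral_cong)
    fix y
    have "(\<integral>\<^sup>+t. ennreal (4 * 5 ^ CARD('n) * p * t powr (p - 1 - 1)) * (ennreal (norm (f y)) * indicator {(t, y). 0 \<le> t \<and> t \<le> 2 * norm (f y)} (t, y)) \<partial>lborel)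
      = (\<integral>\<^sup>+t. ennreal (4 * 5 ^ CARD('n) * p * norm (f y)) * (ennreal (t powr (p - 1 - 1)) * indicator {0..2 * norm (f y)} t) \<partial>lborel)"
      using p by (intro nn_integral_cong) (auto simp: ennreal_mult' mult_ac split: split_indicator)
    also have "\<dots> = ennreal (4 * 5 ^ CARD('n) * p * norm (f y)) * ennreal ((2 * norm (f y)) powr (p - 1) / (p - 1))"
      using nn_integral_powr_from_0[of "2 * norm (f y)" "p - 1"] p
      by (subst nn_integral_cmult) (simp_all del: diff_diff_eq)
    also have "\<dots> = ennreal (4 * p * 5 ^ CARD('n) * 2 powr (p - 1) / (p - 1)) * ennreal (norm (f y) powr p)"
    proof (cases "f y = 0")
      case False
      then have "norm (f y) * norm (f y) powr (p - 1) = norm (f y) powr p" by (simp add: powr_diff)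
      then have "4 * 5 ^ CARD('n) * p * norm (f y) * ((2 * norm (f y)) powr (p - 1) / (p - 1))
        = 4 * p * 5 ^ CARD('n) * 2 powr (p - 1) / (p - 1) * norm (f y) powr p"
        by (simp add: powr_mult mult_ac)
      then show ?thesis using p by (simp add: ennreal_mult[symmetric])
    qed simp
    finally show "(\<integral>\<^sup>+t. ennreal (4 * 5 ^ CARD('n) * p * t powr (p - 1 - 1)) * (ennreal (norm (f y)) * indicator {(t, y). 0 \<le> t \<and> t \<le> 2 * norm (f y)} (t, y)) \<partial>lborel)
      = ennreal (4 * p * 5 ^ CARD('n) * 2 powr (p - 1) / (p - 1)) * ennreal (norm (f y) powr p)" .
  qed
  also have "\<dots> = ennreal (4 * p * 5 ^ CARD('n) * 2 powr (p - 1) / (p - 1)) * (\<integral>\<^sup>+x. ennreal (norm (f x) powr p) \<partial>lebesgue)"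
    by (rule nn_integral_cmult) measurable
  finally show ?thesis .
qed

text \<open>Every finite multiple of the indicator of the set where the maximal function is infinite
  lies below the maximal function. The strong-type bound with \<open>u\<close> equal to
  \<open>t powr (1 / p)\<close> on that set shows that \<open>t\<close> times its measure stays
  bounded as \<open>t\<close> grows.\<close>

lemma AE_maximal_function_finite:
  fixes f :: "real^'n \<Rightarrow> 'b::{banach,second_countable_topology}"
  assumes [measurable]: "f \<in> borel_measurable lebesgue" and M[measurable]: "maximal_function f \<in> borel_measurable lebesgue"
    and p: "1 < p" and fin: "(\<integral>\<^sup>+x. ennreal (norm (f x) powr p) \<partial>lebesgue) < \<infinity>"
  shows "AE x in lebesgue. maximal_function f x < \<infinity>"
proof -
  let ?E = "{x. maximal_function f x = \<infinity>}"
  define A where "A = 4 * p * 5 ^ CARD('n) * 2 powr (p - 1) / (p - 1)"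
  have A0: "0 \<le> A" using p by (simp add: A_def)
  obtain I where I: "(\<integral>\<^sup>+x. ennreal (norm (f x) powr p) \<partial>lebesgue) = ennreal I" "0 \<le> I"
    using fin by (cases "\<integral>\<^sup>+x. ennreal (norm (f x) powr p) \<partial>lebesgue") auto
  have E[measurable]: "?E \<in> sets lebesgue"
    using measurable_sets[OF M, of "{\<infinity>}"] by (simp add: vimage_def)
  have bd: "ennreal t * emeasure lebesgue ?E \<le> ennreal (A * I)" if t: "0 \<le> t" for t
  proof -
    have "(\<integral>\<^sup>+x. ennreal ((t powr (1 / p) * indicator ?E x) powr p) \<partial>lebesgue) \<le> ennreal A * ennreal I"
      unfolding I(1)[symmetric] A_def
      by (rule nn_integral_le_maximal_function) (use p in \<open>auto split: split_indicator\<close>)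
    also have "(\<integral>\<^sup>+x. ennreal ((t powr (1 / p) * indicator ?E x) powr p) \<partial>lebesgue) = (\<integral>\<^sup>+x. ennreal t * indicator ?E x \<partial>lebesgue)"
      using t p by (intro nn_integral_cong) (auto simp: powr_powr split: split_indicator)
    also have "\<dots> = ennreal t * emeasure lebesgue ?E"
      by (rule nn_integral_cmult_indicator) measurable
    finally show ?thesis using A0 I(2) by (simp add: ennreal_mult)
  qed
  have "emeasure lebesgue ?E = 0"
  proof (cases "emeasure lebesgue ?E")
    case (real m)
    have "t * m \<le> A * I" if "0 \<le> t" for t
      using bd[OF that] that real p I by (simp add: ennreal_mult[symmetric] A_def)
    \<comment> \<open>For \<open>m > 0\<close> this choice of \<open>t\<close> would give
      \<open>A * I + 1 \<le> A * I\<close>.\<close>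
    from this[of "(A * I + 1) / m"] have "m = 0"
      using real p I by (cases "m = 0") (auto simp: A_def)
    then show ?thesis using real by simp
  next
    case top
    then show ?thesis using bd[of 1] by (simp add: top_unique)
  qed
  then have "?E \<in> null_sets lebesgue" using E by (intro null_setsI)
  then show ?thesis by (rule AE_I') (auto simp: less_top[symmetric])
qed

section \<open>Morrey spaces\<close>

lemma morrey_modular_nonneg: "0 \<le> morrey_modular p lam f x r"
  by (auto simp: morrey_modular_def set_lebesgue_integral_def)

lemma morrey_space_measurable: "f \<in> morrey_space p lam \<Longrightarrow> f \<in> borel_measurable lebesgue"
  by (simp add: morrey_space_def)

lemma morrey_modular_le_norm:
  assumes "f \<in> morrey_space p lam" "0 < p" "0 < r"
  shows "morrey_modular p lam f x r \<le> morrey_norm p lam f powr p"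
proof -
  have "morrey_modular p lam f x r powr (1 / p) \<le> morrey_norm p lam f"
    unfolding morrey_norm_def
    using assms by (intro cSUP_upper2[where x="(x, r)"]) (auto simp: morrey_space_def)
  then have "(morrey_modular p lam f x r powr (1 / p)) powr p \<le> morrey_norm p lam f powr p"
    using assms by (intro powr_mono2) auto
  then show ?thesis using assms morrey_modular_nonneg[of p lam f x r] by (simp add: powr_powr)
qed

lemma morrey_norm_nonneg:
  assumes "f \<in> morrey_space p lam"
  shows "0 \<le> morrey_norm p lam f"
  unfolding morrey_norm_def
  using assms by (intro cSUP_upper2[where x="(0, 1)"]) (auto simp: morrey_space_def)

text \<open>Members of the space are locally \<open>p\<close>-integrable, so the real integral
  inside the modular is not a default 0. This bridge carries the Morrey hypothesis into the
  \<open>ennreal\<close> estimates.\<close>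

lemma nn_integral_ball_eq_morrey_modular:
  fixes f :: "real^'n \<Rightarrow> 'b::{banach,second_countable_topology}"
  assumes f: "f \<in> morrey_space p lam" and r: "0 < r"
  shows "(\<integral>\<^sup>+y\<in>ball x r. ennreal (norm (f y) powr p) \<partial>lebesgue) = ennreal (r powr lam * morrey_modular p lam f x r)"
proof -
  have "set_integrable lebesgue (ball x r) (\<lambda>y. norm (f y) powr p)"
    by (rule set_integrable_subset[of _ "cball x r"]) (use f in \<open>auto simp: morrey_space_def\<close>)
  then have "(\<integral>\<^sup>+y. ennreal (indicator (ball x r) y * norm (f y) powr p) \<partial>lebesgue)
      = ennreal (LINT y:ball x r|lebesgue. norm (f y) powr p)"
    unfolding set_lebesgue_integral_def set_integrable_def by (subst nn_integral_eq_integral) auto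
  then show ?thesis using r
    by (simp add: morrey_modular_def ennreal_mult' ennreal_indicator mult.commute)
qed

lemma morrey_modular_le:
  fixes f :: "real^'n \<Rightarrow> 'b::{banach,second_countable_topology}"
  assumes "(\<integral>\<^sup>+y\<in>ball x r. ennreal (norm (f y) powr p) \<partial>lebesgue) \<le> ennreal (K * r powr lam)" "0 < r" "0 \<le> K"
  shows "morrey_modular p lam f x r \<le> K"
proof -
  have "(LINT y:ball x r|lebesgue. norm (f y) powr p) \<le> K * r powr lam"
    unfolding set_lebesgue_integral_def
    using assms by (intro integral_real_bounded) (auto simp: ennreal_mult' ennreal_indicator mult.commute)
  then show ?thesis using assms by (simp add: morrey_modular_def field_simps)
qed

lemma compact_subset_ball:
  fixes A :: "'a::real_normed_vector set"
  assumes "compact A"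
  obtains R where "0 < R" "A \<subseteq> ball 0 R"
  using bounded_subset_ballD[OF compact_imp_bounded[OF assms], of 0] by blast

lemma morrey_spaceI:
  fixes f :: "real^'n \<Rightarrow> 'b::{banach,second_countable_topology}"
  assumes [measurable]: "f \<in> borel_measurable lebesgue"
    and bd: "\<And>x r. 0 < r \<Longrightarrow> (\<integral>\<^sup>+y\<in>ball x r. ennreal (norm (f y) powr p) \<partial>lebesgue) \<le> ennreal (K * r powr lam)"
    and "0 \<le> K" "0 < p"
  shows "f \<in> morrey_space p lam"
proof -
  have "set_integrable lebesgue A (\<lambda>y. norm (f y) powr p)" if A: "compact A" for A
  proof -
    obtain R where R: "0 < R" "A \<subseteq> ball 0 R" using compact_subset_ball[OF A] .
    have "set_integrable lebesgue (ball 0 R) (\<lambda>y. norm (f y) powr p)"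
      unfolding set_integrable_def
    proof (rule integrableI_bounded)
      have "(\<integral>\<^sup>+y. ennreal (norm (indicator (ball 0 R) y *\<^sub>R norm (f y) powr p)) \<partial>lebesgue)
          = (\<integral>\<^sup>+y\<in>ball 0 R. ennreal (norm (f y) powr p) \<partial>lebesgue)"
        by (intro nn_integral_cong) (auto split: split_indicator)
      also have "\<dots> < \<infinity>" using bd[OF R(1), of 0] by (auto intro: le_less_trans)
      finally show "(\<integral>\<^sup>+y. ennreal (norm (indicator (ball 0 R) y *\<^sub>R norm (f y) powr p)) \<partial>lebesgue) < \<infinity>" .
    qed measurable
    then show ?thesis
      by (rule set_integrable_subset) (use A R in \<open>auto simp: lmeasurable_compact fmeasurableD\<close>)
  qed
  moreover have "bdd_above ((\<lambda>(x, r). morrey_modular p lam f x r powr (1 / p)) ` (UNIV \<times> {0<..}))"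
    using morrey_modular_le[OF bd] assms morrey_modular_nonneg
    by (intro bdd_aboveI[of _ "K powr (1 / p)"]) (auto intro!: powr_mono2)
  ultimately show ?thesis by (auto simp: morrey_space_def)
qed

lemma morrey_norm_le:
  fixes f :: "real^'n \<Rightarrow> 'b::{banach,second_countable_topology}"
  assumes bd: "\<And>x r. 0 < r \<Longrightarrow> (\<integral>\<^sup>+y\<in>ball x r. ennreal (norm (f y) powr p) \<partial>lebesgue) \<le> ennreal (K * r powr lam)"
    and "0 \<le> K" "0 < p"
  shows "morrey_norm p lam f \<le> K powr (1 / p)"
  unfolding morrey_norm_def
  using morrey_modular_le[OF bd] assms morrey_modular_nonneg
  by (intro cSUP_least) (auto intro!: powr_mono2)

text \<open>The norm of \<open>f y\<close> is at most \<open>1 + norm (f y) powr p\<close>, and the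
  constant 1 is integrable over a compact set.\<close>

lemma morrey_set_integrable_compact:
  fixes f :: "real^'n \<Rightarrow> 'b::{banach,second_countable_topology}"
  assumes f: "f \<in> morrey_space p lam" and p: "1 < p" and A: "compact A"
  shows "set_integrable lebesgue A f"
proof -
  have [measurable]: "f \<in> borel_measurable lebesgue" using f by (rule morrey_space_measurable)
  have [measurable]: "A \<in> sets lebesgue" using A by (simp add: lmeasurable_compact fmeasurableD)
  have "set_integrable lebesgue A (\<lambda>y. 1 + norm (f y) powr p)"
  proof (rule set_integral_add)
    show "set_integrable lebesgue A (\<lambda>y. 1::real)"
      using A by (simp add: set_integrable_def lmeasurable_compact lmeasurable_iff_integrable[symmetric])
    show "set_integrable lebesgue A (\<lambda>y. norm (f y) powr p)"
      using f A by (simp add: morrey_space_def)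
  qed
  then show ?thesis unfolding set_integrable_def
  proof (rule Bochner_Integration.integrable_bound)
    have "norm (f y) \<le> 1 + norm (f y) powr p" for y
    proof (cases "norm (f y) \<le> 1")
      case True
      then show ?thesis by (meson add_increasing2 powr_ge_zero)
    next
      case False
      then have "norm (f y) powr 1 \<le> norm (f y) powr p" using p by (intro powr_mono) auto
      then show ?thesis using False by simp
    qed
    then show "AE y in lebesgue. norm (indicator A y *\<^sub>R f y) \<le> norm (indicator A y *\<^sub>R (1 + norm (f y) powr p))"
      by (intro AE_I2) (auto split: split_indicator intro: order_trans)
  qed measurable
qed

text \<open>The local estimate \<open>bd\<close> is used with two values of \<open>G\<close>:
  slightly more than the \<open>p\<close>-th power of the norm for membership and the norm bound,
  and an arbitrarily small value at large radii for the limit. \<open>G\<close> is taken positive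
  because a positive parameter for Young's inequality is later built from it.\<close>

lemma bounded_on_vanishing_morreyI:
  fixes T :: "(real^'n \<Rightarrow> 'a::{banach,second_countable_topology}) \<Rightarrow> real^'n \<Rightarrow> 'b::{banach,second_countable_topology}"
  assumes p: "1 < p" and C: "0 \<le> C"
    and meas: "\<And>f. f \<in> morrey_space p lam \<Longrightarrow> T f \<in> borel_measurable lebesgue"
    and bd: "\<And>f x r G. f \<in> morrey_space p lam \<Longrightarrow> 0 < r \<Longrightarrow> 0 < G
      \<Longrightarrow> (\<And>s. r \<le> s \<Longrightarrow> morrey_modular p lam f x s \<le> G)
      \<Longrightarrow> (\<integral>\<^sup>+y\<in>ball x r. ennreal (norm (T f y) powr p) \<partial>lebesgue) \<le> ennreal (C * G * r powr lam)"
  shows "bounded_on_vanishing_morrey p lam T"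
  unfolding bounded_on_vanishing_morrey_def
proof (intro exI ballI conjI)
  fix f :: "real^'n \<Rightarrow> 'a" assume fv: "f \<in> vanishing_morrey_space p lam"
  then have f: "f \<in> morrey_space p lam"
    and lim: "((\<lambda>r. SUP x. morrey_modular p lam f x r) \<longlongrightarrow> 0) at_top"
    by (auto simp: vanishing_morrey_space_def)
  define N where "N = morrey_norm p lam f powr p"
  have N: "0 \<le> N" by (simp add: N_def)
  have fN: "morrey_modular p lam f x r \<le> N" if "0 < r" for x r
    unfolding N_def using morrey_modular_le_norm[OF f _ that] p by simp
  have glob: "(\<integral>\<^sup>+y\<in>ball x r. ennreal (norm (T f y) powr p) \<partial>lebesgue) \<le> ennreal (C * N * r powr lam)"
    if r: "0 < r" for x r
  proof -
    let ?I = "\<integral>\<^sup>+y\<in>ball x r. ennreal (norm (T f y) powr p) \<partial>lebesgue"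
    \<comment> \<open>\<open>N\<close> may be 0, whereas \<open>bd\<close> asks for
      \<open>0 < G\<close>. The bound is obtained for \<open>N + e\<close>, and \<open>e\<close>
      tends to 0.\<close>
    have "((\<lambda>e. ennreal (C * (N + e) * r powr lam)) \<longlongrightarrow> ennreal (C * (N + 0) * r powr lam)) (at_right 0)"
      by (intro tendsto_intros)
    moreover have "\<forall>\<^sub>F e in at_right 0. ?I \<le> ennreal (C * (N + e) * r powr lam)"
      unfolding eventually_at_right_field
      using r N by (intro exI[of _ 1]) (auto intro!: bd[OF f] order_trans[OF fN])
    ultimately show ?thesis
      using tendsto_lowerbound[of _ _ "at_right (0::real)" ?I] by simp
  qed
  have CN: "0 \<le> C * N" using C N by simp
  have "T f \<in> morrey_space p lam"
    using morrey_spaceI[OF meas[OF f] glob CN] p by simp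
  moreover have "((\<lambda>r. SUP x. morrey_modular p lam (T f) x r) \<longlongrightarrow> 0) at_top"
  proof (rule tendstoI)
    fix e :: real assume e: "0 < e"
    \<comment> \<open>\<open>C + 1\<close> keeps the quotient meaningful when
      \<open>C = 0\<close>.\<close>
    define G where "G = e / (C + 1) / 2"
    have G: "0 < G" "C * G < e" using e C by (auto simp: G_def field_simps add_pos_nonneg add_nonneg_pos)
    from order_tendstoD(2)[OF lim G(1)] obtain r0 where r0:
      "\<And>r. r0 \<le> r \<Longrightarrow> (SUP x. morrey_modular p lam f x r) < G"
      by (auto simp: eventually_at_top_linorder)
    \<comment> \<open>The threshold is at least 1 to make radii positive; then \<open>N\<close>
      bounds the modulars over all centres and the real supremum is a genuine upper bound.\<close>
    have small: "morrey_modular p lam f x r \<le> G" if "max r0 1 \<le> r" for x r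
    proof -
      have "morrey_modular p lam f x r \<le> (SUP x. morrey_modular p lam f x r)"
        using that by (intro cSUP_upper bdd_aboveI[of _ N]) (auto intro!: fN)
      then show ?thesis using r0[of r] that by simp
    qed
    have "dist (SUP x. morrey_modular p lam (T f) x r) 0 < e" if r: "max r0 1 \<le> r" for r
    proof -
      have *: "morrey_modular p lam (T f) x r \<le> C * G" for x
        using r G(1) C by (intro morrey_modular_le[OF bd[OF f]]) (auto intro!: small)
      then have "(SUP x. morrey_modular p lam (T f) x r) \<le> C * G"
        by (intro cSUP_least) auto
      moreover have "0 \<le> (SUP x. morrey_modular p lam (T f) x r)"
        using * by (intro cSUP_upper2[of _ _ 0] bdd_aboveI[of _ "C * G"] morrey_modular_nonneg) auto
      ultimately show ?thesis using G(2) by simp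
    qed
    then show "\<forall>\<^sub>F r in at_top. dist (SUP x. morrey_modular p lam (T f) x r) 0 < e"
      unfolding eventually_at_top_linorder by blast
  qed
  ultimately show "T f \<in> vanishing_morrey_space p lam"
    by (simp add: vanishing_morrey_space_def)
  have "morrey_norm p lam (T f) \<le> (C * N) powr (1 / p)"
    using morrey_norm_le[OF glob CN] p by simp
  also have "\<dots> = C powr (1 / p) * morrey_norm p lam f"
    using C p morrey_norm_nonneg[OF f] by (simp add: N_def powr_mult powr_powr)
  finally show "morrey_norm p lam (T f) \<le> C powr (1 / p) * morrey_norm p lam f" .
qed

section \<open>The tail integral and the near-far criterion\<close>

text \<open>The kernel is centred at the centre of the ball rather than at the point of evaluation,
  so the tail is a single constant on \<open>ball x r\<close>. The cut at \<open>2 * r\<close> makes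
  |y - z| at least |x - z| / 2 for every \<open>y\<close> in the ball and every \<open>z\<close> in
  the tail.\<close>

definition far_integral :: "(real^'n \<Rightarrow> 'b::real_normed_vector) \<Rightarrow> real^'n \<Rightarrow> real \<Rightarrow> ennreal" where
  "far_integral f x r = (\<integral>\<^sup>+z. indicator {z. 2 * r \<le> dist x z} z * ennreal (norm (f z) / dist x z ^ CARD('n)) \<partial>lebesgue)"

text \<open>Young's inequality with \<open>m powr p = G * s powr (lam - n)\<close>, which up to the
  volume constant bounds the mean of |f|^p over the ball. Both terms become multiples of
  \<open>m * s powr n\<close>, with factors \<open>unit_ball_vol\<close> and 1.\<close>

lemma nn_integral_ball_norm_le:
  fixes f :: "real^'n \<Rightarrow> 'b::{banach,second_countable_topology}"
  assumes f: "f \<in> morrey_space p lam" and p: "1 < p" and s: "0 < s" and G: "0 < G" "morrey_modular p lam f x s \<le> G"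
  shows "(\<integral>\<^sup>+y\<in>ball x s. ennreal (norm (f y)) \<partial>lebesgue)
    \<le> ennreal ((unit_ball_vol (real CARD('n)) + 1) * s powr (real CARD('n)) * (G * s powr (lam - real CARD('n))) powr (1 / p))"
proof -
  let ?V = "unit_ball_vol (real CARD('n))" and ?n = "real CARD('n)"
  have [measurable]: "f \<in> borel_measurable lebesgue" using f by (rule morrey_space_measurable)
  define m where "m = (G * s powr (lam - ?n)) powr (1 / p)"
  have m: "0 < m" using G s by (simp add: m_def)
  have mp: "m powr (1 - p) * (G * s powr lam) = m * s powr ?n"
  proof -
    have "m powr p = G * s powr (lam - ?n)" using G s p by (simp add: m_def powr_powr)
    then show ?thesis using m s G by (simp add: powr_diff field_simps)
  qed
  have "(\<integral>\<^sup>+y\<in>ball x s. ennreal (norm (f y)) \<partial>lebesgue)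
      \<le> ennreal m * (\<integral>\<^sup>+y. indicator (ball x s) y \<partial>lebesgue)
        + ennreal (m powr (1 - p)) * (\<integral>\<^sup>+y. indicator (ball x s) y * ennreal (norm (f y) powr p) \<partial>lebesgue)"
    unfolding mult.commute[of _ "indicator _ _"] using m p by (intro nn_integral_le_Young) auto
  also have "\<dots> \<le> ennreal m * (\<integral>\<^sup>+y. indicator (ball x s) y \<partial>lebesgue) + ennreal (m powr (1 - p)) * ennreal (G * s powr lam)"
    using nn_integral_ball_eq_morrey_modular[OF f s, of x] G(2)
    by (intro add_left_mono mult_left_mono) (auto simp: mult.commute[of _ "indicator _ _"] mult.commute[of G] intro!: ennreal_leI mult_left_mono)
  also have "\<dots> = ennreal (m * (?V * s powr ?n) + m * s powr ?n)"
  proof -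
    have "(\<integral>\<^sup>+y. indicator (ball x s) y \<partial>lebesgue) = ennreal (?V * s powr ?n)"
      using s by (simp add: emeasure_lebesgue_ball powr_realpow del: emeasure_completion)
    then show ?thesis unfolding mp[symmetric] using m s G by (simp add: ennreal_mult)
  qed
  finally show ?thesis
    by (simp only: m_def algebra_simps mult_1_left)
qed

text \<open>After division by the \<open>n\<close>-th power of the radius, the \<open>L^1\<close>
  bound on a ball of radius \<open>s\<close> scales like \<open>s powr ((lam - n) / p)\<close>;
  doubling \<open>s\<close> multiplies it by \<open>q\<close>. The constant depends on none of
  \<open>f\<close>, \<open>x\<close>, \<open>r\<close>, \<open>G\<close>.\<close>

lemma far_integral_le:
  fixes p lam :: real
  assumes p: "1 < p" and lam: "0 \<le> lam" "lam < real CARD('n::finite)"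
  shows "\<exists>C\<ge>0. \<forall>f :: real^'n \<Rightarrow> 'b::{banach,second_countable_topology}. f \<in> morrey_space p lam \<longrightarrow>
    (\<forall>x r G. 0 < r \<longrightarrow> 0 < G \<longrightarrow> (\<forall>s\<ge>r. morrey_modular p lam f x s \<le> G) \<longrightarrow>
      far_integral f x r \<le> ennreal (C * (G * r powr (lam - real CARD('n))) powr (1 / p)))"
proof -
  let ?V = "unit_ball_vol (real CARD('n))" and ?n = "real CARD('n)"
  define q where "q = (2::real) powr ((lam - ?n) / p)"
  have q: "0 \<le> q" "q < 1" using lam p by (auto simp: q_def powr_less_one divide_neg_pos)
  \<comment> \<open>\<open>2 powr n\<close> compares outer and inner radius of a shell,
    \<open>q * q\<close> arises because the \<open>k\<close>-th ball has radius
    \<open>2 ^ (k + 2) * r\<close>, and \<open>1 - q\<close> comes from the geometric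
    series.\<close>
  define C where "C = 2 powr ?n * (?V + 1) * (q * q) / (1 - q)"
  have C: "0 \<le> C" using q by (simp add: C_def add_nonneg_nonneg)
  have "far_integral f x r \<le> ennreal (C * (G * r powr (lam - ?n)) powr (1 / p))"
    if f: "f \<in> morrey_space p lam" and r: "0 < r" and G: "0 < G" "\<And>s. r \<le> s \<Longrightarrow> morrey_modular p lam f x s \<le> G"
    for f :: "real^'n \<Rightarrow> 'b" and x r G
  proof -
    let ?m = "(G * r powr (lam - ?n)) powr (1 / p)"
    have [measurable]: "f \<in> borel_measurable lebesgue" using f by (rule morrey_space_measurable)
    have "far_integral f x r
      = (\<integral>\<^sup>+z. indicator {z. 2 * r \<le> dist x z} z * (ennreal (dist x z powr - ?n) * ennreal (norm (f z))) \<partial>lebesgue)"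
      unfolding far_integral_def
    proof (intro nn_integral_cong)
      fix z
      show "indicator {z. 2 * r \<le> dist x z} z * ennreal (norm (f z) / dist x z ^ CARD('n))
        = indicator {z. 2 * r \<le> dist x z} z * (ennreal (dist x z powr - ?n) * ennreal (norm (f z)))"
      proof (cases "2 * r \<le> dist x z")
        case True
        then have "0 < dist x z" using r by linarith
        then have "dist x z powr - ?n = 1 / dist x z ^ CARD('n)"
          by (simp add: powr_minus_divide powr_realpow del: zero_less_dist_iff)
        then show ?thesis by (simp add: ennreal_mult[symmetric])
      qed simp
    qed
    also have "\<dots> \<le> (\<Sum>k. ennreal ((2 ^ k * (2 * r)) powr - ?n) * (\<integral>\<^sup>+z\<in>ball x (2 ^ (k + 1) * (2 * r)). ennreal (norm (f z)) \<partial>lebesgue))"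
      using r by (intro nn_integral_dyadic_tail) auto
    also have "\<dots> \<le> (\<Sum>k. ennreal ((2 powr ?n * (?V + 1) * (q * q) * ?m) * q ^ k))"
    proof (intro suminf_le summableI)
      fix k
      let ?s = "2 ^ (k + 1) * (2 * r)"
      have "1 \<le> (2::real) ^ k" by simp
      then have "1 \<le> (2::real) ^ k * 4" by linarith
      then have "1 * r \<le> 2 ^ k * 4 * r" using r by (rule mult_right_mono[OF _ less_imp_le])
      then have s: "0 < ?s" "r \<le> ?s" using r by auto
      have e: "(2 ^ k * (2 * r)) powr - ?n * ((?V + 1) * ?s powr ?n * (G * ?s powr (lam - ?n)) powr (1 / p))
          = (2 powr ?n * (?V + 1) * (q * q) * ?m) * q ^ k"
      proof -
        have "?s = 2 * (2 ^ k * (2 * r))" by simp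
        then have "?s powr ?n = 2 powr ?n * (2 ^ k * (2 * r)) powr ?n"
          using r by (simp only: powr_mult)
        then have 1: "(2 ^ k * (2 * r)) powr - ?n * ?s powr ?n = 2 powr ?n"
          using r by (simp add: powr_minus)
        have "?s = 2 ^ (k + 2) * r" by simp
        then have "(G * ?s powr (lam - ?n)) powr (1 / p) = ((2 ^ (k + 2)) powr (lam - ?n)) powr (1 / p) * ?m"
          using r G by (simp only: powr_mult) (simp add: mult_ac)
        also have "((2 ^ (k + 2)) powr (lam - ?n)) powr (1 / p) = q ^ (k + 2)"
          unfolding q_def powr_two_power[symmetric] by (simp only: powr_powr times_divide_eq_right mult_1_right)
        finally have 2: "(G * ?s powr (lam - ?n)) powr (1 / p) = q * q * q ^ k * ?m" by (simp add: mult_ac)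
        show ?thesis unfolding 2 using 1 by (simp add: mult_ac)
      qed
      have "ennreal ((2 ^ k * (2 * r)) powr - ?n) * (\<integral>\<^sup>+z\<in>ball x ?s. ennreal (norm (f z)) \<partial>lebesgue)
        \<le> ennreal ((2 ^ k * (2 * r)) powr - ?n) * ennreal ((?V + 1) * ?s powr ?n * (G * ?s powr (lam - ?n)) powr (1 / p))"
        using s by (intro mult_left_mono nn_integral_ball_norm_le[OF f p _ G(1)] G(2)) auto
      also have "\<dots> = ennreal ((2 powr ?n * (?V + 1) * (q * q) * ?m) * q ^ k)"
        unfolding e[symmetric] by (simp add: ennreal_mult')
      finally show "ennreal ((2 ^ k * (2 * r)) powr - ?n) * (\<integral>\<^sup>+z\<in>ball x ?s. ennreal (norm (f z)) \<partial>lebesgue)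
        \<le> ennreal ((2 powr ?n * (?V + 1) * (q * q) * ?m) * q ^ k)" .
    qed
    also have "\<dots> = ennreal ((2 powr ?n * (?V + 1) * (q * q) * ?m) / (1 - q))"
      using q by (intro suminf_ennreal_geometric) (auto simp: add_nonneg_nonneg)
    finally show ?thesis by (simp add: C_def)
  qed
  with C show ?thesis by blast
qed

lemma far_integral_finite:
  fixes f :: "real^'n \<Rightarrow> 'b::{banach,second_countable_topology}"
  assumes p: "1 < p" and lam: "0 \<le> lam" "lam < real CARD('n)" and f: "f \<in> morrey_space p lam" and r: "0 < r"
  shows "far_integral f x r < \<infinity>"
proof -
  obtain C where "0 \<le> C" and C: "\<And>(f :: real^'n \<Rightarrow> 'b) x r G. f \<in> morrey_space p lam \<Longrightarrow> 0 < r \<Longrightarrow> 0 < G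
      \<Longrightarrow> (\<And>s. r \<le> s \<Longrightarrow> morrey_modular p lam f x s \<le> G)
      \<Longrightarrow> far_integral f x r \<le> ennreal (C * (G * r powr (lam - real CARD('n))) powr (1 / p))"
    using far_integral_le[OF p lam, where ?'b='b] by metis
  \<comment> \<open>Adding 1 to the \<open>p\<close>-th power of the norm keeps \<open>G\<close>
    positive even if the norm is 0.\<close>
  have "far_integral f x r \<le> ennreal (C * ((morrey_norm p lam f powr p + 1) * r powr (lam - real CARD('n))) powr (1 / p))"
    using p r by (intro C f) (auto intro!: add_nonneg_pos order_trans[OF morrey_modular_le_norm[OF f]])
  then show ?thesis by (auto intro: le_less_trans)
qed

lemma powr_add_le:
  fixes a b p :: real
  assumes "0 \<le> a" "0 \<le> b" "0 \<le> p"
  shows "(a + b) powr p \<le> 2 powr p * (a powr p + b powr p)"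
proof -
  have "(a + b) powr p \<le> (2 * max a b) powr p" using assms by (intro powr_mono2) auto
  also have "\<dots> = 2 powr p * max a b powr p" using assms by (simp add: powr_mult)
  also have "\<dots> \<le> 2 powr p * (a powr p + b powr p)" by (intro mult_left_mono) (auto simp: max_def)
  finally show ?thesis .
qed

text \<open>The powers of \<open>r\<close> balance: the near piece gives
  \<open>A * G * (2 * r) powr lam\<close>, while the far piece is a constant whose
  \<open>p\<close>-th power is a multiple of \<open>G * r powr (lam - n)\<close>, and the volume of
  the ball restores \<open>r powr lam\<close>. A majorant \<open>g\<close> in place of an additive
  splitting of \<open>T f\<close> admits sublinear operators.\<close>

lemma bounded_on_vanishing_morrey_near_far:
  fixes T :: "(real^'n \<Rightarrow> 'a::{banach,second_countable_topology}) \<Rightarrow> real^'n \<Rightarrow> 'b::{banach,second_countable_topology}"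
  assumes p: "1 < p" and lam: "0 \<le> lam" "lam < real CARD('n)" and A: "0 \<le> A" and D: "0 \<le> D"
    and meas: "\<And>f. f \<in> morrey_space p lam \<Longrightarrow> T f \<in> borel_measurable lebesgue"
    and near: "\<And>f x r. f \<in> morrey_space p lam \<Longrightarrow> 0 < r \<Longrightarrow>
      \<exists>g :: real^'n \<Rightarrow> real. g \<in> borel_measurable lebesgue \<and> (\<forall>y. 0 \<le> g y)
        \<and> (\<integral>\<^sup>+y. ennreal (g y powr p) \<partial>lebesgue)
            \<le> ennreal A * (\<integral>\<^sup>+y\<in>ball x (2 * r). ennreal (norm (f y) powr p) \<partial>lebesgue)
        \<and> (AE y in lebesgue. y \<in> ball x r \<longrightarrow> ennreal (norm (T f y)) \<le> ennreal (g y) + ennreal D * far_integral f x r)"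
  shows "bounded_on_vanishing_morrey p lam T"
proof -
  let ?V = "unit_ball_vol (real CARD('n))" and ?n = "real CARD('n)"
  obtain C where C: "0 \<le> C" "\<And>(f :: real^'n \<Rightarrow> 'a) x r G. f \<in> morrey_space p lam \<Longrightarrow> 0 < r \<Longrightarrow> 0 < G
      \<Longrightarrow> (\<And>s. r \<le> s \<Longrightarrow> morrey_modular p lam f x s \<le> G)
      \<Longrightarrow> far_integral f x r \<le> ennreal (C * (G * r powr (lam - ?n)) powr (1 / p))"
    using far_integral_le[OF p lam, where ?'b='a] by metis
  show ?thesis
  proof (rule bounded_on_vanishing_morreyI[where C="2 powr p * (A * 2 powr lam + (D * C) powr p * ?V)"])
    fix f :: "real^'n \<Rightarrow> 'a" and x r G
    assume f: "f \<in> morrey_space p lam" and r: "0 < r" and G: "0 < G" "\<And>s. r \<le> s \<Longrightarrow> morrey_modular p lam f x s \<le> G"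
    obtain g :: "real^'n \<Rightarrow> real" where g[measurable]: "g \<in> borel_measurable lebesgue" and g0: "\<And>y. 0 \<le> g y"
      and gA: "(\<integral>\<^sup>+y. ennreal (g y powr p) \<partial>lebesgue)
            \<le> ennreal A * (\<integral>\<^sup>+y\<in>ball x (2 * r). ennreal (norm (f y) powr p) \<partial>lebesgue)"
      and gT: "AE y in lebesgue. y \<in> ball x r \<longrightarrow> ennreal (norm (T f y)) \<le> ennreal (g y) + ennreal D * far_integral f x r"
      using near[OF f r, of x] by blast
    define F where "F = C * (G * r powr (lam - ?n)) powr (1 / p)"
    have F: "0 \<le> F" using C by (simp add: F_def)
    have far: "far_integral f x r \<le> ennreal F" unfolding F_def by (intro C(2) f r G)
    have "(\<integral>\<^sup>+y\<in>ball x r. ennreal (norm (T f y) powr p) \<partial>lebesgue)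
      \<le> (\<integral>\<^sup>+y. ennreal (2 powr p) * (ennreal (g y powr p) + ennreal ((D * F) powr p) * indicator (ball x r) y) \<partial>lebesgue)"
    proof (rule nn_integral_mono_AE, rule AE_mp[OF gT], intro AE_I2 impI)
      fix y assume y: "y \<in> ball x r \<longrightarrow> ennreal (norm (T f y)) \<le> ennreal (g y) + ennreal D * far_integral f x r"
      show "ennreal (norm (T f y) powr p) * indicator (ball x r) y
        \<le> ennreal (2 powr p) * (ennreal (g y powr p) + ennreal ((D * F) powr p) * indicator (ball x r) y)"
      proof (cases "y \<in> ball x r")
        case True
        have "ennreal (norm (T f y)) \<le> ennreal (g y) + ennreal D * ennreal F"
          using y True by (auto intro!: order_trans[OF _ add_left_mono[OF mult_left_mono[OF far]]])
        then have "norm (T f y) \<le> g y + D * F"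
          using g0 D F by (simp add: ennreal_mult[symmetric] ennreal_plus[symmetric] del: ennreal_plus)
        then have "norm (T f y) powr p \<le> (g y + D * F) powr p" using p by (intro powr_mono2) auto
        also have "\<dots> \<le> 2 powr p * (g y powr p + (D * F) powr p)" using g0 D F p by (intro powr_add_le) auto
        finally show ?thesis using True
          by (simp add: ennreal_mult[symmetric] ennreal_plus[symmetric] ennreal_leI del: ennreal_plus)
      qed simp
    qed
    also have "\<dots> = ennreal (2 powr p) * ((\<integral>\<^sup>+y. ennreal (g y powr p) \<partial>lebesgue) + ennreal ((D * F) powr p) * emeasure lebesgue (ball x r))"
      by (simp add: nn_integral_add nn_integral_cmult nn_integral_cmult_indicator del: emeasure_completion)
    also have "\<dots> \<le> ennreal (2 powr p) * (ennreal A * ennreal ((2 * r) powr lam * G) + ennreal ((D * F) powr p) * ennreal (?V * r powr ?n))"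
    proof (intro mult_left_mono add_mono order_trans[OF gA])
      show "(\<integral>\<^sup>+y\<in>ball x (2 * r). ennreal (norm (f y) powr p) \<partial>lebesgue) \<le> ennreal ((2 * r) powr lam * G)"
        using r by (subst nn_integral_ball_eq_morrey_modular[OF f]) (auto intro!: ennreal_leI mult_left_mono G(2))
      show "emeasure lebesgue (ball x r) \<le> ennreal (?V * r powr ?n)"
        using r by (simp add: emeasure_lebesgue_ball powr_realpow del: emeasure_completion)
    qed auto
    also have "\<dots> = ennreal (2 powr p * (A * 2 powr lam + (D * C) powr p * ?V) * G * r powr lam)"
    proof -
      have "F powr p = C powr p * G * r powr (lam - ?n)" using C G r p by (simp add: F_def powr_mult powr_powr)
      then have "2 powr p * (A * ((2 * r) powr lam * G) + (D * F) powr p * (?V * r powr ?n))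
        = 2 powr p * (A * 2 powr lam + (D * C) powr p * ?V) * G * r powr lam"
        using D F C r by (simp add: powr_mult powr_diff field_simps)
      then show ?thesis using A G(1)
        by (simp add: ennreal_mult[symmetric] ennreal_plus[symmetric] del: ennreal_plus)
    qed
    finally show "(\<integral>\<^sup>+y\<in>ball x r. ennreal (norm (T f y) powr p) \<partial>lebesgue)
      \<le> ennreal (2 powr p * (A * 2 powr lam + (D * C) powr p * ?V) * G * r powr lam)" .
  qed (use p A C D meas in auto)
qed

section \<open>Operators dominated by the maximal function\<close>

text \<open>The cut is at the radius where \<open>far_integral\<close> begins, so the two pieces
  together exhaust \<open>f\<close>.\<close>

definition near_part :: "(real^'n \<Rightarrow> 'b::real_normed_vector) \<Rightarrow> real^'n \<Rightarrow> real \<Rightarrow> real^'n \<Rightarrow> 'b" where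
  "near_part f x r y = indicator (ball x (2 * r)) y *\<^sub>R f y"

lemma near_part_measurable[measurable]:
  fixes f :: "real^'n \<Rightarrow> 'b::{banach,second_countable_topology}"
  assumes [measurable]: "f \<in> borel_measurable lebesgue"
  shows "near_part f x r \<in> borel_measurable lebesgue"
  unfolding near_part_def[abs_def] by measurable

lemma nn_integral_near_part:
  "(\<integral>\<^sup>+y. ennreal (norm (near_part f x r y) powr p) \<partial>lebesgue)
    = (\<integral>\<^sup>+y\<in>ball x (2 * r). ennreal (norm (f y) powr p) \<partial>lebesgue)"
  by (intro nn_integral_cong) (auto simp: near_part_def split: split_indicator)

lemma near_part_set_integrable:
  fixes f :: "real^'n \<Rightarrow> 'b::{banach,second_countable_topology}"
  assumes f: "f \<in> morrey_space p lam" and p: "1 < p" and A: "A \<in> sets lebesgue"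
  shows "set_integrable lebesgue A (near_part f x r)"
proof -
  have "set_integrable lebesgue (ball x (2 * r)) f"
    by (rule set_integrable_subset[OF morrey_set_integrable_compact[OF f p, of "cball x (2 * r)"]]) auto
  then have "set_integrable lebesgue UNIV (near_part f x r)"
    by (simp add: set_integrable_def near_part_def)
  then show ?thesis by (rule set_integrable_subset) (use A in auto)
qed

lemma nn_integral_near_part_finite:
  fixes f :: "real^'n \<Rightarrow> 'b::{banach,second_countable_topology}"
  assumes f: "f \<in> morrey_space p lam" and r: "0 < r"
  shows "(\<integral>\<^sup>+y. ennreal (norm (near_part f x r y) powr p) \<partial>lebesgue) < \<infinity>"
  unfolding nn_integral_near_part using r by (subst nn_integral_ball_eq_morrey_modular[OF f]) auto

lemma maximal_function_near_part_measurable: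
  fixes f :: "real^'n \<Rightarrow> 'b::{banach,second_countable_topology}"
  assumes f: "f \<in> morrey_space p lam" and p: "1 < p"
  shows "maximal_function (near_part f x r) \<in> borel_measurable lebesgue"
  using near_part_set_integrable[OF f p] morrey_space_measurable[OF f]
  by (intro borel_measurable_maximal_function near_part_measurable) (auto simp: lmeasurable_compact fmeasurableD)

text \<open>If \<open>z\<close> lies in \<open>ball y t\<close> and |x - z| is at least 2r, then t >
  |y - z|, which is at least |x - z| - r and hence at least |x - z| / 2. Dividing by the volume of
  \<open>ball y t\<close> thus costs at most \<open>2 ^ n / unit_ball_vol\<close> times |x -
  z|^(-n).\<close>

lemma maximal_function_le_near_far:
  fixes f :: "real^'n \<Rightarrow> 'b::{banach,second_countable_topology}"
  assumes [measurable]: "f \<in> borel_measurable lebesgue" and r: "0 < r" and y: "y \<in> ball x r"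
  shows "maximal_function f y \<le> maximal_function (near_part f x r) y
    + ennreal (2 ^ CARD('n) / unit_ball_vol (real CARD('n))) * far_integral f x r"
  unfolding maximal_function_def[of f]
proof (rule SUP_least)
  fix t :: real assume "t \<in> {0<..}"
  then have t: "0 < t" by simp
  let ?V = "unit_ball_vol (real CARD('n))" and ?N = "CARD('n)"
  let ?F = "\<lambda>z. indicator {z. 2 * r \<le> dist x z} z * ennreal (norm (f z) / dist x z ^ ?N)"
  have V: "0 < ?V" by simp
  have "(\<integral>\<^sup>+z\<in>ball y t. ennreal (norm (f z)) \<partial>lebesgue)
    \<le> (\<integral>\<^sup>+z. ennreal (norm (near_part f x r z)) * indicator (ball y t) z + ennreal ((2 * t) ^ ?N) * ?F z \<partial>lebesgue)"
  proof (rule nn_integral_mono)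
    fix z
    show "ennreal (norm (f z)) * indicator (ball y t) z
      \<le> ennreal (norm (near_part f x r z)) * indicator (ball y t) z + ennreal ((2 * t) ^ ?N) * ?F z"
    proof (cases "z \<in> ball y t \<and> 2 * r \<le> dist x z")
      case True
      then have d: "0 < dist x z" "dist x z \<le> 2 * t"
        using y r dist_triangle[of x z y] by (auto simp: dist_commute)
      have "dist x z ^ ?N \<le> (2 * t) ^ ?N" using d by (intro power_mono) auto
      then have "norm (f z) * dist x z ^ ?N \<le> norm (f z) * (2 * t) ^ ?N" by (intro mult_left_mono) auto
      then have "norm (f z) \<le> (2 * t) ^ ?N * (norm (f z) / dist x z ^ ?N)"
        using d(1) by (simp add: field_simps)
      then have "ennreal (norm (f z)) \<le> ennreal ((2 * t) ^ ?N * (norm (f z) / dist x z ^ ?N))" by (rule ennreal_leI)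
      also have "\<dots> = ennreal ((2 * t) ^ ?N) * ?F z" using t True by (subst ennreal_mult) auto
      finally show ?thesis using True by (auto intro!: add_increasing simp del: power_mult_distrib)
    next
      case False
      then show ?thesis by (auto simp: near_part_def split: split_indicator)
    qed
  qed
  also have "\<dots> = (\<integral>\<^sup>+z\<in>ball y t. ennreal (norm (near_part f x r z)) \<partial>lebesgue) + ennreal ((2 * t) ^ ?N) * far_integral f x r"
    by (simp add: nn_integral_add nn_integral_cmult far_integral_def)
  finally have "(\<integral>\<^sup>+z\<in>ball y t. ennreal (norm (f z)) \<partial>lebesgue) / emeasure lebesgue (ball y t)
    \<le> ((\<integral>\<^sup>+z\<in>ball y t. ennreal (norm (near_part f x r z)) \<partial>lebesgue) + ennreal ((2 * t) ^ ?N) * far_integral f x r)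
        / emeasure lebesgue (ball y t)"
    by (rule divide_right_mono_ennreal)
  also have "\<dots> = (\<integral>\<^sup>+z\<in>ball y t. ennreal (norm (near_part f x r z)) \<partial>lebesgue) / emeasure lebesgue (ball y t)
      + ennreal ((2 * t) ^ ?N) * far_integral f x r / emeasure lebesgue (ball y t)"
    by (rule add_divide_distrib_ennreal)
  also have "\<dots> \<le> maximal_function (near_part f x r) y + ennreal (2 ^ ?N / ?V) * far_integral f x r"
  proof (rule add_mono)
    show "(\<integral>\<^sup>+z\<in>ball y t. ennreal (norm (near_part f x r z)) \<partial>lebesgue) / emeasure lebesgue (ball y t)
      \<le> maximal_function (near_part f x r) y"
      unfolding maximal_function_def using t by (intro SUP_upper) auto
    have "ennreal ((2 * t) ^ ?N) * far_integral f x r / emeasure lebesgue (ball y t)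
      = (ennreal ((2 * t) ^ ?N) / ennreal (?V * t ^ ?N)) * far_integral f x r"
      using t by (simp add: emeasure_lebesgue_ball ennreal_times_divide mult.commute del: emeasure_completion)
    also have "ennreal ((2 * t) ^ ?N) / ennreal (?V * t ^ ?N) = ennreal (2 ^ ?N / ?V)"
      using t V by (subst divide_ennreal) (auto simp: power_mult_distrib)
    finally show "ennreal ((2 * t) ^ ?N) * far_integral f x r / emeasure lebesgue (ball y t)
      \<le> ennreal (2 ^ ?N / ?V) * far_integral f x r" by simp
  qed
  finally show "(\<integral>\<^sup>+z\<in>ball y t. ennreal (norm (f z)) \<partial>lebesgue) / emeasure lebesgue (ball y t)
    \<le> maximal_function (near_part f x r) y + ennreal (2 ^ ?N / ?V) * far_integral f x r" .
qed

lemma AE_maximal_function_near_part_finite: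
  fixes f :: "real^'n \<Rightarrow> 'b::{banach,second_countable_topology}"
  assumes f: "f \<in> morrey_space p lam" and p: "1 < p" and r: "0 < r"
  shows "AE y in lebesgue. maximal_function (near_part f x r) y < \<infinity>"
  using morrey_space_measurable[OF f] maximal_function_near_part_measurable[OF f p] p nn_integral_near_part_finite[OF f r]
  by (intro AE_maximal_function_finite near_part_measurable)

lemma AE_lebesgueI_balls:
  assumes "\<And>R. 0 < R \<Longrightarrow> AE x::real^'n in lebesgue. x \<in> ball 0 R \<longrightarrow> P x"
  shows "AE x in lebesgue. P x"
proof -
  have "AE x::real^'n in lebesgue. \<forall>k::nat. x \<in> ball 0 (real (Suc k)) \<longrightarrow> P x"
    unfolding AE_all_countable using assms by simp
  then show ?thesis
  proof (rule AE_mp, intro AE_I2 impI)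
    fix x :: "real^'n" assume *: "\<forall>k::nat. x \<in> ball 0 (real (Suc k)) \<longrightarrow> P x"
    obtain k :: nat where "norm x < real k" using reals_Archimedean2 by blast
    then show "P x" using *[rule_format, of k] by simp
  qed
qed

text \<open>On each ball about the origin, the near part is \<open>p\<close>-integrable and has an
  a.e. finite maximal function, and the tail is finite.\<close>

lemma AE_maximal_function_finite_morrey:
  fixes f :: "real^'n \<Rightarrow> 'b::{banach,second_countable_topology}"
  assumes p: "1 < p" and lam: "0 \<le> lam" "lam < real CARD('n)" and f: "f \<in> morrey_space p lam"
  shows "AE y in lebesgue. maximal_function f y < \<infinity>"
proof (rule AE_lebesgueI_balls)
  fix R :: real assume R: "0 < R"
  show "AE y in lebesgue. y \<in> ball 0 R \<longrightarrow> maximal_function f y < \<infinity>"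
    using AE_maximal_function_near_part_finite[OF f p R, of 0]
  proof (rule AE_mp, intro AE_I2 impI)
    fix y assume "maximal_function (near_part f 0 R) y < \<infinity>" and y: "y \<in> ball 0 R"
    then have "maximal_function (near_part f 0 R) y
      + ennreal (2 ^ CARD('n) / unit_ball_vol (real CARD('n))) * far_integral f 0 R < \<infinity>"
      using far_integral_finite[OF p lam f R, of 0] by (simp add: ennreal_mult_less_top)
    then show "maximal_function f y < \<infinity>"
      using maximal_function_le_near_far[OF morrey_space_measurable[OF f] R y] by (rule le_less_trans[rotated])
  qed
qed

lemma bounded_on_vanishing_morrey_if_le_maximal:
  fixes T :: "(real^'n \<Rightarrow> 'a::{banach,second_countable_topology}) \<Rightarrow> real^'n \<Rightarrow> 'b::{banach,second_countable_topology}"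
  assumes p: "1 < p" and lam: "0 \<le> lam" "lam < real CARD('n)" and D: "0 \<le> D"
    and meas: "\<And>f. f \<in> morrey_space p lam \<Longrightarrow> T f \<in> borel_measurable lebesgue"
    and dom: "\<And>f y. f \<in> morrey_space p lam \<Longrightarrow> ennreal (norm (T f y)) \<le> ennreal D * maximal_function f y"
  shows "bounded_on_vanishing_morrey p lam T"
proof -
  define A where "A = 4 * p * 5 ^ CARD('n) * 2 powr (p - 1) / (p - 1)"
  have A: "0 \<le> A" using p by (simp add: A_def)
  let ?c = "2 ^ CARD('n) / unit_ball_vol (real CARD('n))"
  show ?thesis
  proof (rule bounded_on_vanishing_morrey_near_far[OF p lam, where A="D powr p * A" and D="D * ?c"])
    fix f :: "real^'n \<Rightarrow> 'a" and x :: "real^'n" and r :: real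
    assume f: "f \<in> morrey_space p lam" and r: "0 < r"
    let ?M = "maximal_function (near_part f x r)"
    have [measurable]: "f \<in> borel_measurable lebesgue" using f by (rule morrey_space_measurable)
    have [measurable]: "?M \<in> borel_measurable lebesgue" by (rule maximal_function_near_part_measurable[OF f p])
    show "\<exists>g :: real^'n \<Rightarrow> real. g \<in> borel_measurable lebesgue \<and> (\<forall>y. 0 \<le> g y)
        \<and> (\<integral>\<^sup>+y. ennreal (g y powr p) \<partial>lebesgue)
            \<le> ennreal (D powr p * A) * (\<integral>\<^sup>+y\<in>ball x (2 * r). ennreal (norm (f y) powr p) \<partial>lebesgue)
        \<and> (AE y in lebesgue. y \<in> ball x r \<longrightarrow> ennreal (norm (T f y)) \<le> ennreal (g y) + ennreal (D * ?c) * far_integral f x r)"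
    \<comment> \<open>\<open>enn2real\<close> sends infinity to 0, so this \<open>g\<close> loses
      the bound where the maximal function of the near part is infinite; that set is null, and the
      criterion asks for an a.e. bound.\<close>
    proof (intro exI[of _ "\<lambda>y. D * enn2real (?M y)"] conjI allI)
      show "(\<lambda>y. D * enn2real (?M y)) \<in> borel_measurable lebesgue" by measurable
      show "0 \<le> D * enn2real (?M y)" for y using D by simp
      have "(\<integral>\<^sup>+y. ennreal ((D * enn2real (?M y)) powr p) \<partial>lebesgue)
        = ennreal (D powr p) * (\<integral>\<^sup>+y. ennreal (enn2real (?M y) powr p) \<partial>lebesgue)"
        using D by (subst nn_integral_cmult[symmetric]) (auto simp: powr_mult ennreal_mult)
      also have "\<dots> \<le> ennreal (D powr p) * (ennreal A * (\<integral>\<^sup>+y. ennreal (norm (near_part f x r y) powr p) \<partial>lebesgue))"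
        unfolding A_def using p
        by (intro mult_left_mono nn_integral_le_maximal_function) (auto simp: ennreal_enn2real_if)
      finally show "(\<integral>\<^sup>+y. ennreal ((D * enn2real (?M y)) powr p) \<partial>lebesgue)
            \<le> ennreal (D powr p * A) * (\<integral>\<^sup>+y\<in>ball x (2 * r). ennreal (norm (f y) powr p) \<partial>lebesgue)"
        using A by (simp add: nn_integral_near_part ennreal_mult mult.assoc)
      show "AE y in lebesgue. y \<in> ball x r \<longrightarrow>
          ennreal (norm (T f y)) \<le> ennreal (D * enn2real (?M y)) + ennreal (D * ?c) * far_integral f x r"
        using AE_maximal_function_near_part_finite[OF f p r, of x]
      proof (rule AE_mp, intro AE_I2 impI)
        fix y assume fin: "?M y < \<infinity>" and y: "y \<in> ball x r"
        have "ennreal (norm (T f y)) \<le> ennreal D * maximal_function f y" by (rule dom[OF f])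
        also have "\<dots> \<le> ennreal D * (?M y + ennreal ?c * far_integral f x r)"
          by (intro mult_left_mono maximal_function_le_near_far r y) auto
        also have "\<dots> = ennreal (D * enn2real (?M y)) + ennreal (D * ?c) * far_integral f x r"
        proof -
          have "ennreal (D * ?c) = ennreal D * ennreal ?c" using D by (intro ennreal_mult) auto
          moreover have "ennreal (D * enn2real (?M y)) = ennreal D * ?M y" using D fin by (simp add: ennreal_mult)
          ultimately show ?thesis by (simp only: distrib_left mult.assoc)
        qed
        finally show "ennreal (norm (T f y)) \<le> ennreal (D * enn2real (?M y)) + ennreal (D * ?c) * far_integral f x r" .
      qed
    qed
  qed (use A D meas in auto)
qed

text \<open>The mean over a ball has norm at most the average of |f| over it, so subtracting the
  mean at most doubles the average.\<close>

lemma sharp_maximal_function_le: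
  fixes f :: "real^'n \<Rightarrow> 'b::{banach,second_countable_topology}"
  assumes [measurable]: "f \<in> borel_measurable lebesgue" and int: "\<And>A. compact A \<Longrightarrow> set_integrable lebesgue A f"
  shows "sharp_maximal_function f x \<le> 2 * maximal_function f x"
  unfolding sharp_maximal_function_def
proof (rule SUP_least)
  fix t :: real assume "t \<in> {0<..}"
  then have t: "0 < t" by simp
  define v where "v = unit_ball_vol (real CARD('n)) * t ^ CARD('n)"
  have v: "0 < v" "emeasure lebesgue (ball x t) = ennreal v"
    using t by (auto simp: v_def emeasure_lebesgue_ball simp del: emeasure_completion)
  let ?I = "\<integral>\<^sup>+y\<in>ball x t. ennreal (norm (f y)) \<partial>lebesgue"
  have "set_integrable lebesgue (ball x t) f"
    by (rule set_integrable_subset[OF int[of "cball x t"]]) auto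
  then have "ennreal (norm (LINT y:ball x t|lebesgue. f y)) \<le> (\<integral>\<^sup>+y. ennreal (norm (indicator (ball x t) y *\<^sub>R f y)) \<partial>lebesgue)"
    unfolding set_lebesgue_integral_def set_integrable_def by (rule integral_norm_bound_ennreal)
  also have "\<dots> = ?I" by (intro nn_integral_cong) (auto split: split_indicator)
  finally have L: "ennreal (norm (LINT y:ball x t|lebesgue. f y)) \<le> ?I" .
  have "measure lebesgue (ball x t) = v" using v by (simp add: measure_def)
  then have "norm (ball_mean f x t) * v = norm (LINT y:ball x t|lebesgue. f y)"
    using v by (simp add: ball_mean_def)
  then have m: "ennreal (norm (ball_mean f x t)) * ennreal v \<le> ?I"
    using L v by (simp add: ennreal_mult[symmetric])
  have "(\<integral>\<^sup>+y\<in>ball x t. ennreal (norm (f y - ball_mean f x t)) \<partial>lebesgue)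
    \<le> (\<integral>\<^sup>+y. ennreal (norm (f y)) * indicator (ball x t) y + ennreal (norm (ball_mean f x t)) * indicator (ball x t) y \<partial>lebesgue)"
    by (intro nn_integral_mono)
      (auto split: split_indicator simp: ennreal_plus[symmetric] simp del: ennreal_plus intro!: ennreal_leI norm_triangle_ineq4)
  also have "\<dots> = ?I + ennreal (norm (ball_mean f x t)) * ennreal v"
    using v by (simp add: nn_integral_add nn_integral_cmult_indicator del: emeasure_completion)
  also have "\<dots> \<le> 2 * ?I" using m by (simp add: mult_2 add_left_mono)
  finally have "(\<integral>\<^sup>+y\<in>ball x t. ennreal (norm (f y - ball_mean f x t)) \<partial>lebesgue) / emeasure lebesgue (ball x t)
    \<le> 2 * ?I / emeasure lebesgue (ball x t)" by (rule divide_right_mono_ennreal)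
  also have "\<dots> = 2 * (?I / emeasure lebesgue (ball x t))" by (simp add: ennreal_times_divide)
  also have "\<dots> \<le> 2 * maximal_function f x"
    unfolding maximal_function_def using t by (intro mult_left_mono SUP_upper) auto
  finally show "(\<integral>\<^sup>+y\<in>ball x t. ennreal (norm (f y - ball_mean f x t)) \<partial>lebesgue) / emeasure lebesgue (ball x t)
    \<le> 2 * maximal_function f x" .
qed

text \<open>The ball of radius |x| about the origin lies in \<open>ball x (2 * norm x)\<close>,
  whose volume is \<open>2 ^ n * unit_ball_vol\<close> times |x|^n. At \<open>x = 0\<close> the
  domain of integration is empty and the operator vanishes.\<close>

lemma norm_hardy_operator_le:
  fixes f :: "real^'n \<Rightarrow> 'b::{banach,second_countable_topology}"
  assumes [measurable]: "f \<in> borel_measurable lebesgue" and int: "\<And>A. compact A \<Longrightarrow> set_integrable lebesgue A f"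
  shows "ennreal (norm (hardy_operator f x)) \<le> ennreal (2 ^ CARD('n) * unit_ball_vol (real CARD('n))) * maximal_function f x"
proof (cases "x = 0")
  case False
  let ?V = "unit_ball_vol (real CARD('n))" and ?N = "CARD('n)"
  have V: "0 < ?V" by simp
  then have V0: "?V \<noteq> 0" by linarith
  have x: "0 < norm x" using False by simp
  have set: "{y. norm y < norm x} = ball 0 (norm x)" by auto
  let ?I = "\<integral>\<^sup>+y\<in>ball x (2 * norm x). ennreal (norm (f y)) \<partial>lebesgue"
  have "set_integrable lebesgue (ball 0 (norm x)) f"
    by (rule set_integrable_subset[OF int[of "cball 0 (norm x)"]]) auto
  then have "ennreal (norm (LINT y:ball 0 (norm x)|lebesgue. f y)) \<le> (\<integral>\<^sup>+y. ennreal (norm (indicator (ball 0 (norm x)) y *\<^sub>R f y)) \<partial>lebesgue)"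
    unfolding set_lebesgue_integral_def set_integrable_def by (rule integral_norm_bound_ennreal)
  also have "\<dots> \<le> ?I"
  proof (rule nn_integral_mono)
    fix y :: "real^'n"
    have "y \<in> ball x (2 * norm x)" if "y \<in> ball 0 (norm x)"
      using that dist_triangle[of x y 0] by auto
    then show "ennreal (norm (indicator (ball 0 (norm x)) y *\<^sub>R f y)) \<le> ennreal (norm (f y)) * indicator (ball x (2 * norm x)) y"
      by (auto split: split_indicator)
  qed
  finally have L: "ennreal (norm (LINT y:ball 0 (norm x)|lebesgue. f y)) \<le> ?I" .
  have "ennreal (norm (hardy_operator f x)) = ennreal (1 / norm x ^ ?N) * ennreal (norm (LINT y:ball 0 (norm x)|lebesgue. f y))"
    using x by (simp add: hardy_operator_def set ennreal_mult[symmetric])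
  also have "\<dots> \<le> ennreal (1 / norm x ^ ?N) * ?I" by (intro mult_left_mono L) auto
  also have "ennreal (1 / norm x ^ ?N) = ennreal (2 ^ ?N * ?V) / ennreal (?V * (2 * norm x) ^ ?N)"
    using x V V0 by (subst divide_ennreal) (auto simp: field_simps)
  also have "\<dots> * ?I = ennreal (2 ^ ?N * ?V) * (?I / emeasure lebesgue (ball x (2 * norm x)))"
    by (simp add: emeasure_lebesgue_ball ennreal_times_divide mult.commute del: emeasure_completion)
  also have "\<dots> \<le> ennreal (2 ^ ?N * ?V) * maximal_function f x"
    unfolding maximal_function_def using x by (intro mult_left_mono SUP_upper) auto
  finally show ?thesis .
qed (simp add: hardy_operator_def set_lebesgue_integral_def)

lemma borel_measurable_hardy_operator:
  fixes f :: "real^'n \<Rightarrow> 'b::{banach,second_countable_topology}"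
  assumes [measurable]: "f \<in> borel_measurable lebesgue"
  shows "hardy_operator f \<in> borel_measurable lebesgue"
  unfolding hardy_operator_def[abs_def] set_lebesgue_integral_def by measurable

lemma maximal_function_bounded:
  fixes p lam :: real
  assumes p: "1 < p" and lam: "0 \<le> lam" "lam < real CARD('n::finite)"
  shows "bounded_on_vanishing_morrey p lam (\<lambda>(f :: real^'n \<Rightarrow> 'a::{banach,second_countable_topology}) x. enn2real (maximal_function f x))"
proof (rule bounded_on_vanishing_morrey_if_le_maximal[OF p lam, where D=1])
  fix f :: "real^'n \<Rightarrow> 'a" assume f: "f \<in> morrey_space p lam"
  have [measurable]: "maximal_function f \<in> borel_measurable lebesgue"
    by (rule borel_measurable_maximal_function[OF morrey_space_measurable[OF f] morrey_set_integrable_compact[OF f p]])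
  show "(\<lambda>x. enn2real (maximal_function f x)) \<in> borel_measurable lebesgue" by measurable
  show "ennreal (norm (enn2real (maximal_function f y))) \<le> ennreal 1 * maximal_function f y" for y
    by (simp add: ennreal_enn2real_if)
qed simp

lemma sharp_maximal_function_bounded:
  fixes p lam :: real
  assumes p: "1 < p" and lam: "0 \<le> lam" "lam < real CARD('n::finite)"
  shows "bounded_on_vanishing_morrey p lam (\<lambda>(f :: real^'n \<Rightarrow> 'a::{banach,second_countable_topology}) x. enn2real (sharp_maximal_function f x))"
proof (rule bounded_on_vanishing_morrey_if_le_maximal[OF p lam, where D=2])
  fix f :: "real^'n \<Rightarrow> 'a" assume f: "f \<in> morrey_space p lam"
  note f' = morrey_space_measurable[OF f] morrey_set_integrable_compact[OF f p]
  have [measurable]: "sharp_maximal_function f \<in> borel_measurable lebesgue"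
    by (rule borel_measurable_sharp_maximal_function[OF f'])
  show "(\<lambda>x. enn2real (sharp_maximal_function f x)) \<in> borel_measurable lebesgue" by measurable
  show "ennreal (norm (enn2real (sharp_maximal_function f y))) \<le> ennreal 2 * maximal_function f y" for y
    using sharp_maximal_function_le[OF f', of y] by (auto simp: ennreal_enn2real_if)
qed simp

lemma hardy_operator_bounded:
  fixes p lam :: real
  assumes p: "1 < p" and lam: "0 \<le> lam" "lam < real CARD('n::finite)"
  shows "bounded_on_vanishing_morrey p lam (hardy_operator :: (real^'n \<Rightarrow> 'a::{banach,second_countable_topology}) \<Rightarrow> real^'n \<Rightarrow> 'a)"
proof (rule bounded_on_vanishing_morrey_if_le_maximal[OF p lam, where D="2 ^ CARD('n) * unit_ball_vol (real CARD('n))"])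
  fix f :: "real^'n \<Rightarrow> 'a" assume f: "f \<in> morrey_space p lam"
  show "hardy_operator f \<in> borel_measurable lebesgue"
    by (rule borel_measurable_hardy_operator[OF morrey_space_measurable[OF f]])
  show "ennreal (norm (hardy_operator f y)) \<le> ennreal (2 ^ CARD('n) * unit_ball_vol (real CARD('n))) * maximal_function f y" for y
    by (rule norm_hardy_operator_le[OF morrey_space_measurable[OF f] morrey_set_integrable_compact[OF f p]])
qed simp

section \<open>The dual Hardy operator\<close>

text \<open>The dual Hardy operator applied to |f|, in \<open>ennreal\<close> so that it is
  available before integrability is known.\<close>

definition dual_hardy_majorant :: "(real^'n \<Rightarrow> 'b::real_normed_vector) \<Rightarrow> real^'n \<Rightarrow> ennreal" where
  "dual_hardy_majorant f x = (\<integral>\<^sup>+y. indicator {y. norm x < norm y} y * ennreal (norm (f y) / norm y ^ CARD('n)) \<partial>lebesgue)"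

lemma dual_hardy_majorant_measurable[measurable]:
  fixes f :: "real^'n \<Rightarrow> 'b::{banach,second_countable_topology}"
  assumes [measurable]: "f \<in> borel_measurable lebesgue"
  shows "dual_hardy_majorant f \<in> borel_measurable lebesgue"
proof -
  have "(\<lambda>x. \<integral>\<^sup>+y. indicator {(x, y). norm x < norm y} (x, y) * ennreal (norm (f y) / norm y ^ CARD('n)) \<partial>lebesgue)
     \<in> borel_measurable lebesgue" by measurable
  then show ?thesis unfolding dual_hardy_majorant_def[abs_def]
    by (rule measurable_cong[THEN iffD1, rotated]) (auto intro!: nn_integral_cong split: split_indicator)
qed

text \<open>The Schur test with weight \<open>|y| powr (n / p)\<close>.\<close>

lemma dual_hardy_majorant_pointwise:
  fixes p :: real
  assumes p: "1 < p"
  shows "\<exists>C\<ge>0. \<forall>(f :: real^'n \<Rightarrow> 'b::{banach,second_countable_topology}) x. f \<in> borel_measurable lebesgue \<longrightarrow> x \<noteq> 0 \<longrightarrow>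
    ennreal (enn2real (dual_hardy_majorant f x) powr p)
      \<le> ennreal (C * norm x powr - (real CARD('n) - real CARD('n) / p))
        * (\<integral>\<^sup>+y. indicator {y. norm x < norm y} y * ennreal (norm y powr - (real CARD('n) / p)) * ennreal (norm (f y) powr p) \<partial>lebesgue)"
proof -
  let ?n = "real CARD('n)"
  \<comment> \<open>The kernel |y|^(-n) is split as |y|^(-n-b) times |y|^b. Since
    \<open>b * p = n\<close>, the weight times the \<open>p\<close>-th power of |f(y)| |y|^b
    collapses to |y|^(-b) |f(y)|^p, while the weight alone has tail mass of order |x|^(-b).\<close>
  define b where "b = ?n / p"
  have b: "0 < b" using p by (simp add: b_def)
  obtain C where C: "0 \<le> C"
    "\<And>s. 0 < s \<Longrightarrow> (\<integral>\<^sup>+z. indicator {z::real^'n. s \<le> norm z} z * ennreal (norm z powr - (?n + b)) \<partial>lebesgue)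
        \<le> ennreal (C * s powr - b)"
    using nn_integral_tail_powr_le[OF b, where ?'n='n] by blast
  have "ennreal (enn2real (dual_hardy_majorant f x) powr p) \<le> ennreal ((C + 1) powr p * norm x powr - (?n - b)) * J"
    if [measurable]: "f \<in> borel_measurable lebesgue" and x: "x \<noteq> 0"
      and J: "J = (\<integral>\<^sup>+y. indicator {y. norm x < norm y} y * ennreal (norm y powr - b) * ennreal (norm (f y) powr p) \<partial>lebesgue)"
    for f :: "real^'n \<Rightarrow> 'b" and x J
  proof (cases J)
    \<comment> \<open>The right-hand side is infinite here: its real factor is positive because
      \<open>C + 1 > 0\<close> and \<open>x \<noteq> 0\<close>.\<close>
    case top
    then show ?thesis using x C by (simp add: ennreal_mult_top)
  next
    case (real j)
    let ?w = "\<lambda>y::real^'n. indicator {y. norm x < norm y} y * ennreal (norm y powr - (?n + b))"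
    have nx: "0 < norm x" using x by simp
    have Hw: "dual_hardy_majorant f x = (\<integral>\<^sup>+y. ?w y * ennreal (norm (f y) * norm y powr b) \<partial>lebesgue)"
      unfolding dual_hardy_majorant_def
    proof (intro nn_integral_cong)
      fix y :: "real^'n"
      have "norm (f y) / norm y ^ CARD('n) = norm y powr - (?n + b) * (norm (f y) * norm y powr b)" if "norm x < norm y"
        using that nx by (auto simp: powr_minus powr_add powr_diff powr_realpow field_simps)
      then show "indicator {y. norm x < norm y} y * ennreal (norm (f y) / norm y ^ CARD('n)) = ?w y * ennreal (norm (f y) * norm y powr b)"
        by (auto split: split_indicator simp: ennreal_mult[symmetric])
    qed
    have Jw: "(\<integral>\<^sup>+y. ?w y * ennreal ((norm (f y) * norm y powr b) powr p) \<partial>lebesgue) = J"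
      unfolding J
    proof (intro nn_integral_cong)
      fix y :: "real^'n"
      have "norm y powr - (?n + b) * (norm (f y) * norm y powr b) powr p = norm y powr - b * norm (f y) powr p" if "norm x < norm y"
      proof -
        have y: "0 < norm y" using that nx by linarith
        have "b * p = ?n" using p by (simp add: b_def)
        then have "(norm (f y) * norm y powr b) powr p = norm (f y) powr p * norm y powr ?n"
          by (simp add: powr_mult powr_powr)
        then show ?thesis using y by (simp add: powr_minus powr_add powr_diff field_simps)
      qed
      then show "?w y * ennreal ((norm (f y) * norm y powr b) powr p)
        = indicator {y. norm x < norm y} y * ennreal (norm y powr - b) * ennreal (norm (f y) powr p)"
        by (auto split: split_indicator simp: ennreal_mult[symmetric])
    qed
    have W: "(\<integral>\<^sup>+y. ?w y \<partial>lebesgue) \<le> ennreal (C * norm x powr - b)"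
      by (rule order_trans[OF nn_integral_mono C(2)[OF nx]]) (auto split: split_indicator)
    have H: "dual_hardy_majorant f x \<le> ennreal (m * (C * norm x powr - b) + m powr (1 - p) * j)" if m: "0 < m" for m
    proof -
      have "dual_hardy_majorant f x \<le> ennreal m * (\<integral>\<^sup>+y. ?w y \<partial>lebesgue) + ennreal (m powr (1 - p)) * J"
        unfolding Hw Jw[symmetric] by (rule nn_integral_le_Young) (use m p in auto)
      also have "\<dots> \<le> ennreal m * ennreal (C * norm x powr - b) + ennreal (m powr (1 - p)) * ennreal j"
        unfolding real by (intro add_mono mult_left_mono W order_refl) auto
      also have "\<dots> = ennreal (m * (C * norm x powr - b) + m powr (1 - p) * j)"
        using m C real by (simp add: ennreal_mult[symmetric])
      finally show ?thesis .
    qed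
    have H': "enn2real (dual_hardy_majorant f x) \<le> m * (C * norm x powr - b) + m powr (1 - p) * j" if m: "0 < m" for m
      using H[OF m] m C(1) real by (intro enn2real_leI) (auto simp: add_nonneg_nonneg)
    have "enn2real (dual_hardy_majorant f x) powr p \<le> (C + 1) powr p * norm x powr - (?n - b) * j"
    proof (cases "j = 0")
      case True
      \<comment> \<open>Only the first term of Young's inequality survives when
        \<open>j = 0\<close>, and it tends to 0 with \<open>m\<close>.\<close>
      have "enn2real (dual_hardy_majorant f x) \<le> 0"
      proof (rule field_le_epsilon)
        fix e :: real assume e: "0 < e"
        define m where "m = e / (C * norm x powr - b + 1)"
        have d: "0 < C * norm x powr - b + 1" using C by (simp add: add_nonneg_pos)
        then have "0 < m" using e by (simp add: m_def)
        from H'[OF this] have "enn2real (dual_hardy_majorant f x) \<le> m * (C * norm x powr - b)" using True by simp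
        also have "\<dots> \<le> m * (C * norm x powr - b + 1)" using \<open>0 < m\<close> by (intro mult_left_mono) auto
        also have "\<dots> = e" using d by (simp add: m_def)
        finally show "enn2real (dual_hardy_majorant f x) \<le> 0 + e" by simp
      qed
      then have "enn2real (dual_hardy_majorant f x) = 0" using enn2real_nonneg antisym by blast
      then show ?thesis using True by simp
    next
      case False
      then have j: "0 < j" using real by simp
      text \<open>Balances the two terms of Young's inequality.\<close>
      define m where "m = (j * norm x powr b) powr (1 / p)"
      have m: "0 < m" using j nx by (simp add: m_def)
      have mp: "m powr p = j * norm x powr b" using j nx p by (simp add: m_def powr_powr)
      have "m powr (1 - p) * j = m * norm x powr - b"
        using m mp j nx by (simp add: powr_diff powr_minus field_simps)
      then have "enn2real (dual_hardy_majorant f x) \<le> (C + 1) * (m * norm x powr - b)"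
        using H'[OF m] by (simp add: algebra_simps)
      then have "enn2real (dual_hardy_majorant f x) powr p \<le> ((C + 1) * (m * norm x powr - b)) powr p"
        using p by (intro powr_mono2) auto
      also have "\<dots> = (C + 1) powr p * (m powr p * norm x powr - (b * p))"
        using C m by (simp add: powr_mult powr_powr)
      also have "m powr p * norm x powr - (b * p) = norm x powr - (?n - b) * j"
      proof -
        have "b * p = ?n" using p by (simp add: b_def)
        then show ?thesis using nx by (simp add: mp powr_minus powr_diff field_simps)
      qed
      finally show ?thesis by (simp add: mult.assoc)
    qed
    then show ?thesis using real by (simp add: ennreal_mult[symmetric] ennreal_leI)
  qed
  then show ?thesis unfolding b_def
    by (intro exI[of _ "(C + 1) powr p"]) (auto simp: b_def)
qed

text \<open>Interchanging the integrals in the pointwise bound leaves the integral of |x|^(-c) over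
  |x| < |y|, where c = n - n/p is below n. It is of order |y|^(n/p), which cancels the weight
  |y|^(-n/p).\<close>

lemma dual_hardy_majorant_Lp:
  fixes p :: real
  assumes p: "1 < p"
  shows "\<exists>A\<ge>0. \<forall>(f :: real^'n \<Rightarrow> 'b::{banach,second_countable_topology}). f \<in> borel_measurable lebesgue \<longrightarrow>
    (\<integral>\<^sup>+x. ennreal (enn2real (dual_hardy_majorant f x) powr p) \<partial>lebesgue)
      \<le> ennreal A * (\<integral>\<^sup>+y. ennreal (norm (f y) powr p) \<partial>lebesgue)"
proof -
  let ?n = "real CARD('n)"
  let ?c = "?n - ?n / p"
  have c: "0 \<le> ?c" "?c < ?n" using p by (auto simp: field_simps)
  obtain C1 where C1: "0 \<le> C1" "\<And>(f :: real^'n \<Rightarrow> 'b) x. f \<in> borel_measurable lebesgue \<Longrightarrow> x \<noteq> 0 \<Longrightarrow>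
    ennreal (enn2real (dual_hardy_majorant f x) powr p)
      \<le> ennreal (C1 * norm x powr - ?c)
        * (\<integral>\<^sup>+y. indicator {y. norm x < norm y} y * ennreal (norm y powr - (?n / p)) * ennreal (norm (f y) powr p) \<partial>lebesgue)"
    using dual_hardy_majorant_pointwise[OF p, where ?'n='n and ?'b='b] by blast
  obtain C2 where C2: "0 \<le> C2"
    "\<And>s. 0 \<le> s \<Longrightarrow> (\<integral>\<^sup>+z::real^'n\<in>ball 0 s. ennreal (norm z powr - ?c) \<partial>lebesgue)
        \<le> ennreal (C2 * s powr (?n - ?c))"
    using nn_integral_ball_powr_le[OF c] by blast
  have "(\<integral>\<^sup>+x. ennreal (enn2real (dual_hardy_majorant f x) powr p) \<partial>lebesgue)
      \<le> ennreal (C1 * C2) * (\<integral>\<^sup>+y. ennreal (norm (f y) powr p) \<partial>lebesgue)"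
    if [measurable]: "f \<in> borel_measurable lebesgue" for f :: "real^'n \<Rightarrow> 'b"
  proof -
    let ?F = "\<lambda>y. ennreal (norm y powr - (?n / p)) * ennreal (norm (f y) powr p)"
    let ?k = "\<lambda>(x::real^'n) (y::real^'n). ennreal (C1 * norm x powr - ?c) * (indicator {(x, y). norm x < norm y} (x, y) * ?F y)"
    have "(\<integral>\<^sup>+x. ennreal (enn2real (dual_hardy_majorant f x) powr p) \<partial>lebesgue) \<le> (\<integral>\<^sup>+x. (\<integral>\<^sup>+y. ?k x y \<partial>lebesgue) \<partial>lebesgue)"
    proof (rule nn_integral_mono_AE)
      show "AE x in lebesgue. ennreal (enn2real (dual_hardy_majorant f x) powr p) \<le> (\<integral>\<^sup>+y. ?k x y \<partial>lebesgue)"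
        using AE_lebesgue_neq[of 0]
      proof (rule AE_mp, intro AE_I2 impI)
        fix x :: "real^'n" assume "x \<noteq> 0"
        from C1(2)[OF that this]
        show "ennreal (enn2real (dual_hardy_majorant f x) powr p) \<le> (\<integral>\<^sup>+y. ?k x y \<partial>lebesgue)"
        proof (rule order_trans)
          have "(\<integral>\<^sup>+y. ?k x y \<partial>lebesgue) = ennreal (C1 * norm x powr - ?c) * (\<integral>\<^sup>+y. indicator {(x, y). norm x < norm y} (x, y) * ?F y \<partial>lebesgue)"
            by (rule nn_integral_cmult) measurable
          also have "(\<integral>\<^sup>+y. indicator {(x, y). norm x < norm y} (x, y) * ?F y \<partial>lebesgue)
            = (\<integral>\<^sup>+y. indicator {y. norm x < norm y} y * ennreal (norm y powr - (?n / p)) * ennreal (norm (f y) powr p) \<partial>lebesgue)"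
            by (intro nn_integral_cong) (auto split: split_indicator)
          finally show "ennreal (C1 * norm x powr - ?c) * (\<integral>\<^sup>+y. indicator {y. norm x < norm y} y * ennreal (norm y powr - (?n / p)) * ennreal (norm (f y) powr p) \<partial>lebesgue)
             \<le> (\<integral>\<^sup>+y. ?k x y \<partial>lebesgue)" by simp
        qed
      qed
    qed
    also have "\<dots> = (\<integral>\<^sup>+y. (\<integral>\<^sup>+x. ?k x y \<partial>lebesgue) \<partial>lebesgue)"
      by (rule lebesgue_pair.Fubini') measurable
    also have "\<dots> \<le> (\<integral>\<^sup>+y. ennreal (C1 * C2) * ennreal (norm (f y) powr p) \<partial>lebesgue)"
    proof (rule nn_integral_mono)
      fix y :: "real^'n"
      have "(\<integral>\<^sup>+x. ?k x y \<partial>lebesgue) = (\<integral>\<^sup>+(x::real^'n). (ennreal C1 * ?F y) * (ennreal (norm x powr - ?c) * indicator (ball 0 (norm y)) x) \<partial>lebesgue)"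
        using C1(1) by (intro nn_integral_cong) (auto split: split_indicator simp: ennreal_mult mult_ac)
      also have "\<dots> = (ennreal C1 * ?F y) * (\<integral>\<^sup>+x\<in>ball (0::real^'n) (norm y). ennreal (norm x powr - ?c) \<partial>lebesgue)"
        by (rule nn_integral_cmult) measurable
      also have "\<dots> \<le> (ennreal C1 * ?F y) * ennreal (C2 * norm y powr (?n - ?c))"
        by (intro mult_left_mono C2(2)) auto
      also have "\<dots> \<le> ennreal (C1 * C2) * ennreal (norm (f y) powr p)"
      proof (cases "y = 0")
        case False
        then have "norm y powr - (?n / p) * norm y powr (?n - ?c) = 1" by (simp add: powr_add[symmetric])
        moreover have "C1 * (norm y powr - (?n / p) * norm (f y) powr p) * (C2 * norm y powr (?n - ?c))
            = C1 * C2 * norm (f y) powr p * (norm y powr - (?n / p) * norm y powr (?n - ?c))"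
          by (simp only: mult_ac)
        ultimately have e: "C1 * (norm y powr - (?n / p) * norm (f y) powr p) * (C2 * norm y powr (?n - ?c)) = C1 * C2 * norm (f y) powr p"
          by (simp only: mult_1_right)
        have "(ennreal C1 * ?F y) * ennreal (C2 * norm y powr (?n - ?c))
            = ennreal (C1 * (norm y powr - (?n / p) * norm (f y) powr p) * (C2 * norm y powr (?n - ?c)))"
          using C1(1) C2(1) by (simp add: ennreal_mult)
        then show ?thesis unfolding e using C1(1) C2(1) by (simp add: ennreal_mult)
      qed simp
      finally show "(\<integral>\<^sup>+x. ?k x y \<partial>lebesgue) \<le> ennreal (C1 * C2) * ennreal (norm (f y) powr p)" .
    qed
    also have "\<dots> = ennreal (C1 * C2) * (\<integral>\<^sup>+y. ennreal (norm (f y) powr p) \<partial>lebesgue)"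
      by (rule nn_integral_cmult) measurable
    finally show ?thesis .
  qed
  then show ?thesis using C1(1) C2(1) by (intro exI[of _ "C1 * C2"]) auto
qed

text \<open>For |z| > |y| and |x - z| at least 2r, the distance |x - z| is at most r + |y| + |z|,
  hence at most |x - z| / 2 + 2 |z|. So it is at most 4 |z|, wherever the origin lies relative to
  the ball.\<close>

lemma dual_hardy_majorant_le_near_far:
  fixes f :: "real^'n \<Rightarrow> 'b::{banach,second_countable_topology}"
  assumes [measurable]: "f \<in> borel_measurable lebesgue" and r: "0 < r" and y: "y \<in> ball x r"
  shows "dual_hardy_majorant f y \<le> dual_hardy_majorant (near_part f x r) y + ennreal (4 ^ CARD('n)) * far_integral f x r"
proof -
  let ?N = "CARD('n)"
  let ?F = "\<lambda>z. indicator {z. 2 * r \<le> dist x z} z * ennreal (norm (f z) / dist x z ^ ?N)"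
  have "dual_hardy_majorant f y \<le> (\<integral>\<^sup>+z. indicator {z. norm y < norm z} z * ennreal (norm (near_part f x r z) / norm z ^ ?N)
      + ennreal (4 ^ ?N) * ?F z \<partial>lebesgue)"
    unfolding dual_hardy_majorant_def
  proof (rule nn_integral_mono)
    fix z
    show "indicator {z. norm y < norm z} z * ennreal (norm (f z) / norm z ^ ?N)
      \<le> indicator {z. norm y < norm z} z * ennreal (norm (near_part f x r z) / norm z ^ ?N) + ennreal (4 ^ ?N) * ?F z"
    proof (cases "norm y < norm z \<and> 2 * r \<le> dist x z")
      case True
      then have z: "0 < norm z" using norm_ge_zero[of y] by linarith
      have "dist x z \<le> dist x y + dist y z" by (rule dist_triangle)
      moreover have "dist y z \<le> norm y + norm z" by (metis dist_norm norm_triangle_ineq4)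
      ultimately have d: "0 < dist x z" "dist x z \<le> 4 * norm z" using True r y by auto
      have "dist x z ^ ?N \<le> (4 * norm z) ^ ?N" using d by (intro power_mono) auto
      then have "norm (f z) * dist x z ^ ?N \<le> norm (f z) * (4 * norm z) ^ ?N" by (intro mult_left_mono) auto
      then have "norm (f z) / norm z ^ ?N \<le> 4 ^ ?N * (norm (f z) / dist x z ^ ?N)"
        using d(1) z by (simp add: field_simps)
      then have "ennreal (norm (f z) / norm z ^ ?N) \<le> ennreal (4 ^ ?N * (norm (f z) / dist x z ^ ?N))" by (rule ennreal_leI)
      also have "\<dots> = ennreal (4 ^ ?N) * ?F z" using True by (subst ennreal_mult) auto
      finally show ?thesis using True by (auto intro!: add_increasing)
    next
      case False
      then show ?thesis by (auto simp: near_part_def split: split_indicator)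
    qed
  qed
  also have "\<dots> = dual_hardy_majorant (near_part f x r) y + ennreal (4 ^ ?N) * far_integral f x r"
    by (simp add: nn_integral_add nn_integral_cmult far_integral_def dual_hardy_majorant_def)
  finally show ?thesis .
qed

text \<open>The near part is integrable, and for |z| > |y| > 0 the kernel |z|^(-n) is bounded by
  |y|^(-n).\<close>

lemma dual_hardy_majorant_near_finite:
  fixes f :: "real^'n \<Rightarrow> 'b::{banach,second_countable_topology}"
  assumes f: "f \<in> morrey_space p lam" and p: "1 < p" and y: "y \<noteq> 0"
  shows "dual_hardy_majorant (near_part f x r) y < \<infinity>"
proof -
  have [measurable]: "f \<in> borel_measurable lebesgue" by (rule morrey_space_measurable[OF f])
  have "integrable lebesgue (near_part f x r)"
    using near_part_set_integrable[OF f p, of UNIV x r] by (simp add: set_integrable_def)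
  then have fin: "(\<integral>\<^sup>+z. ennreal (norm (near_part f x r z)) \<partial>lebesgue) < \<infinity>"
    by (simp add: integrable_iff_bounded)
  have "dual_hardy_majorant (near_part f x r) y \<le> (\<integral>\<^sup>+z. ennreal (1 / norm y ^ CARD('n)) * ennreal (norm (near_part f x r z)) \<partial>lebesgue)"
    unfolding dual_hardy_majorant_def
  proof (rule nn_integral_mono)
    fix z
    have "norm (near_part f x r z) / norm z ^ CARD('n) \<le> 1 / norm y ^ CARD('n) * norm (near_part f x r z)" if "norm y < norm z"
    proof -
      have "0 < norm z" using that norm_ge_zero[of y] by linarith
      then show ?thesis using that y by (auto intro!: divide_left_mono power_mono mult_pos_pos)
    qed
    then show "indicator {z. norm y < norm z} z * ennreal (norm (near_part f x r z) / norm z ^ CARD('n))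
      \<le> ennreal (1 / norm y ^ CARD('n)) * ennreal (norm (near_part f x r z))"
      by (auto split: split_indicator simp: ennreal_mult'[symmetric] intro!: ennreal_leI)
  qed
  also have "\<dots> = ennreal (1 / norm y ^ CARD('n)) * (\<integral>\<^sup>+z. ennreal (norm (near_part f x r z)) \<partial>lebesgue)"
    by (rule nn_integral_cmult) measurable
  also have "\<dots> < \<infinity>" using fin by (simp add: ennreal_mult_less_top)
  finally show ?thesis .
qed

lemma dual_hardy_majorant_finite:
  fixes f :: "real^'n \<Rightarrow> 'b::{banach,second_countable_topology}"
    and y :: "real^'n"
  assumes p: "1 < p" and lam: "0 \<le> lam" "lam < real CARD('n)" and f: "f \<in> morrey_space p lam" and y: "y \<noteq> 0"
  shows "dual_hardy_majorant f y < \<infinity>"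
proof -
  \<comment> \<open>The splitting is centred at \<open>y\<close> itself, with radius 1.\<close>
  have "dual_hardy_majorant f y \<le> dual_hardy_majorant (near_part f y 1) y + ennreal (4 ^ CARD('n)) * far_integral f y 1"
    by (rule dual_hardy_majorant_le_near_far[OF morrey_space_measurable[OF f]]) auto
  also have "\<dots> < \<infinity>"
    using dual_hardy_majorant_near_finite[OF f p y, of y 1] far_integral_finite[OF p lam f, of 1 y]
    by (simp add: ennreal_mult_less_top)
  finally show ?thesis .
qed

lemma dual_hardy_set_integrable:
  fixes f :: "real^'n \<Rightarrow> 'b::{banach,second_countable_topology}"
    and y :: "real^'n"
  assumes p: "1 < p" and lam: "0 \<le> lam" "lam < real CARD('n)" and f: "f \<in> morrey_space p lam" and y: "y \<noteq> 0"
  shows "set_integrable lebesgue {z. norm z > norm y} (\<lambda>z. (1 / norm z ^ CARD('n)) *\<^sub>R f z)"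
  unfolding set_integrable_def
proof (rule integrableI_bounded)
  have [measurable]: "f \<in> borel_measurable lebesgue" by (rule morrey_space_measurable[OF f])
  show "(\<lambda>z. indicator {z. norm z > norm y} z *\<^sub>R (1 / norm z ^ CARD('n)) *\<^sub>R f z) \<in> borel_measurable lebesgue"
    by measurable
  have "(\<integral>\<^sup>+z. ennreal (norm (indicator {z. norm z > norm y} z *\<^sub>R (1 / norm z ^ CARD('n)) *\<^sub>R f z)) \<partial>lebesgue) = dual_hardy_majorant f y"
    unfolding dual_hardy_majorant_def by (intro nn_integral_cong) (auto split: split_indicator)
  then show "(\<integral>\<^sup>+z. ennreal (norm (indicator {z. norm z > norm y} z *\<^sub>R (1 / norm z ^ CARD('n)) *\<^sub>R f z)) \<partial>lebesgue) < \<infinity>"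
    using dual_hardy_majorant_finite[OF p lam f y] by simp
qed

lemma norm_dual_hardy_operator_le:
  fixes f :: "real^'n \<Rightarrow> 'b::{banach,second_countable_topology}"
    and y :: "real^'n"
  assumes p: "1 < p" and lam: "0 \<le> lam" "lam < real CARD('n)" and f: "f \<in> morrey_space p lam" and y: "y \<noteq> 0"
  shows "ennreal (norm (dual_hardy_operator f y)) \<le> dual_hardy_majorant f y"
proof -
  have "ennreal (norm (dual_hardy_operator f y))
      \<le> (\<integral>\<^sup>+z. ennreal (norm (indicator {z. norm z > norm y} z *\<^sub>R (1 / norm z ^ CARD('n)) *\<^sub>R f z)) \<partial>lebesgue)"
    using dual_hardy_set_integrable[OF p lam f y]
    unfolding dual_hardy_operator_def set_lebesgue_integral_def set_integrable_def by (rule integral_norm_bound_ennreal)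
  also have "\<dots> = dual_hardy_majorant f y"
    unfolding dual_hardy_majorant_def by (intro nn_integral_cong) (auto split: split_indicator)
  finally show ?thesis .
qed

lemma borel_measurable_dual_hardy_operator:
  fixes f :: "real^'n \<Rightarrow> 'b::{banach,second_countable_topology}"
  assumes [measurable]: "f \<in> borel_measurable lebesgue"
  shows "dual_hardy_operator f \<in> borel_measurable lebesgue"
  unfolding dual_hardy_operator_def[abs_def] set_lebesgue_integral_def by measurable

lemma dual_hardy_operator_bounded:
  fixes p lam :: real
  assumes p: "1 < p" and lam: "0 \<le> lam" "lam < real CARD('n::finite)"
  shows "bounded_on_vanishing_morrey p lam (dual_hardy_operator :: (real^'n \<Rightarrow> 'a::{banach,second_countable_topology}) \<Rightarrow> real^'n \<Rightarrow> 'a)"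
proof -
  obtain A where A: "0 \<le> A" "\<And>f :: real^'n \<Rightarrow> 'a. f \<in> borel_measurable lebesgue \<Longrightarrow>
    (\<integral>\<^sup>+x. ennreal (enn2real (dual_hardy_majorant f x) powr p) \<partial>lebesgue)
      \<le> ennreal A * (\<integral>\<^sup>+y. ennreal (norm (f y) powr p) \<partial>lebesgue)"
    using dual_hardy_majorant_Lp[OF p, where ?'b='a and ?'n='n] by blast
  show ?thesis
  proof (rule bounded_on_vanishing_morrey_near_far[OF p lam A(1), where D="4 ^ CARD('n)"])
    fix f :: "real^'n \<Rightarrow> 'a" and x :: "real^'n" and r :: real
    assume f: "f \<in> morrey_space p lam" and r: "0 < r"
    have [measurable]: "f \<in> borel_measurable lebesgue" using f by (rule morrey_space_measurable)
    let ?M = "dual_hardy_majorant (near_part f x r)"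
    show "\<exists>g :: real^'n \<Rightarrow> real. g \<in> borel_measurable lebesgue \<and> (\<forall>y. 0 \<le> g y)
        \<and> (\<integral>\<^sup>+y. ennreal (g y powr p) \<partial>lebesgue)
            \<le> ennreal A * (\<integral>\<^sup>+y\<in>ball x (2 * r). ennreal (norm (f y) powr p) \<partial>lebesgue)
        \<and> (AE y in lebesgue. y \<in> ball x r \<longrightarrow> ennreal (norm (dual_hardy_operator f y)) \<le> ennreal (g y) + ennreal (4 ^ CARD('n)) * far_integral f x r)"
    proof (intro exI[of _ "\<lambda>y. enn2real (?M y)"] conjI allI)
      show "(\<lambda>y. enn2real (?M y)) \<in> borel_measurable lebesgue" by measurable
      show "(\<integral>\<^sup>+y. ennreal (enn2real (?M y) powr p) \<partial>lebesgue)
            \<le> ennreal A * (\<integral>\<^sup>+y\<in>ball x (2 * r). ennreal (norm (f y) powr p) \<partial>lebesgue)"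
        unfolding nn_integral_near_part[symmetric] by (rule A(2)) measurable
      show "AE y in lebesgue. y \<in> ball x r \<longrightarrow>
          ennreal (norm (dual_hardy_operator f y)) \<le> ennreal (enn2real (?M y)) + ennreal (4 ^ CARD('n)) * far_integral f x r"
        using AE_lebesgue_neq[of 0]
      proof (rule AE_mp, intro AE_I2 impI)
        fix y assume y: "y \<noteq> 0" "y \<in> ball x r"
        have "ennreal (norm (dual_hardy_operator f y)) \<le> dual_hardy_majorant f y"
          by (rule norm_dual_hardy_operator_le[OF p lam f y(1)])
        also have "\<dots> \<le> ?M y + ennreal (4 ^ CARD('n)) * far_integral f x r"
          by (rule dual_hardy_majorant_le_near_far[OF _ r y(2)]) measurable
        finally show "ennreal (norm (dual_hardy_operator f y)) \<le> ennreal (enn2real (?M y)) + ennreal (4 ^ CARD('n)) * far_integral f x r"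
          using dual_hardy_majorant_near_finite[OF f p y(1), of x r] by simp
      qed
    qed simp
  next
    fix f :: "real^'n \<Rightarrow> 'a" assume f: "f \<in> morrey_space p lam"
    show "dual_hardy_operator f \<in> borel_measurable lebesgue"
      by (rule borel_measurable_dual_hardy_operator[OF morrey_space_measurable[OF f]])
  qed simp
qed

section \<open>Singular integrals\<close>

text \<open>The preimage of each set of a countable basis agrees with a set of \<open>M\<close> off
  a null set. The union \<open>Z\<close> of these null sets is null, and resetting the function to a
  constant on \<open>Z\<close> makes all basic preimages measurable at once.\<close>

lemma borel_measurable_completion_representative:
  fixes f :: "'a \<Rightarrow> 'b::second_countable_topology"
  assumes f: "f \<in> borel_measurable (completion M)"
  obtains g where "g \<in> borel_measurable M" "AE x in M. f x = g x"
proof -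
  obtain B :: "'b set set" where B: "countable B" "topological_basis B"
    using ex_countable_basis by blast
  have "\<exists>S N'. N' \<in> null_sets M \<and> S \<in> sets M \<and> (f -` U \<inter> space M) - N' = S - N'" if "U \<in> B" for U
  proof -
    have "f -` U \<inter> space (completion M) \<in> sets (completion M)"
      using that B by (intro measurable_sets[OF f] borel_open) (auto intro: topological_basis_open)
    then obtain S N N' where "f -` U \<inter> space M = S \<union> N" "N \<subseteq> N'" "N' \<in> null_sets M" "S \<in> sets M"
      by (auto elim: sets_completionE)
    then show ?thesis by (intro exI[of _ S] exI[of _ N']) auto
  qed
  then obtain S N' where SN: "\<And>U. U \<in> B \<Longrightarrow> N' U \<in> null_sets M \<and> S U \<in> sets M \<and> (f -` U \<inter> space M) - N' U = S U - N' U"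
    by metis
  define Z where "Z = (\<Union>U\<in>B. N' U)"
  have Z: "Z \<in> null_sets M" unfolding Z_def using B(1) SN by (intro null_sets_UN') auto
  define c :: 'b where "c = undefined"
  define g where "g x = (if x \<in> Z then c else f x)" for x
  have "g \<in> measurable M (sigma UNIV B)"
  proof (rule measurable_measure_of)
    fix U assume U: "U \<in> B"
    have "g -` U \<inter> space M = (S U - Z) \<union> (if c \<in> U then Z \<inter> space M else {})"
    proof -
      have "(f -` U \<inter> space M) - N' U = S U - N' U" "N' U \<subseteq> Z" using SN[OF U] U by (auto simp: Z_def)
      then have "(f -` U \<inter> space M) - Z = S U - Z" by blast
      then show ?thesis by (auto simp: g_def set_eq_iff split: if_splits)
    qed
    then show "g -` U \<inter> space M \<in> sets M" using SN[OF U] Z by auto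
  qed auto
  then have "g \<in> borel_measurable M" using borel_eq_countable_basis[OF B] by simp
  moreover have "AE x in M. f x = g x" using Z by (rule AE_I') (auto simp: g_def)
  ultimately show ?thesis by (rule that)
qed

text \<open>Completeness of the measure absorbs the exceptional set. This serves for sections of the
  kernel and for the singular integral, which is given only through a limit.\<close>

lemma borel_measurable_lebesgue_AE_cong:
  fixes f g :: "'a::euclidean_space \<Rightarrow> 'b::topological_space"
  assumes f: "f \<in> borel_measurable lebesgue" and ae: "AE x in lebesgue. f x = g x"
  shows "g \<in> borel_measurable lebesgue"
proof (rule borel_measurableI)
  fix U :: "'b set" assume U: "open U"
  show "g -` U \<inter> space lebesgue \<in> sets lebesgue"
  proof (rule completion.in_sets_AE)
    show "AE x in lebesgue. x \<in> f -` U \<inter> space lebesgue \<longleftrightarrow> x \<in> g -` U \<inter> space lebesgue"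
      using ae by eventually_elim auto
    show "f -` U \<inter> space lebesgue \<in> sets lebesgue" using U by (intro measurable_sets[OF f]) auto
  qed auto
qed

text \<open>Measurability of \<open>K\<close> refers to the completion of the product measure, which
  gives no measurability of individual sections and is not what measurability of parametrized
  integrals needs. A Borel representative is jointly measurable, and by Fubini almost all of its
  sections agree a.e. with those of \<open>K\<close>.\<close>

lemma kernel_representative:
  fixes K :: "real^'n \<Rightarrow> real^'n \<Rightarrow> 'a::second_countable_topology"
  assumes K: "(\<lambda>(x, y). K x y) \<in> borel_measurable lebesgue"
  obtains K' where "(\<lambda>(x, y). K' x y) \<in> borel_measurable (lebesgue \<Otimes>\<^sub>M lebesgue)"
    "AE x in lebesgue. AE y in lebesgue. K x y = K' x y"
proof -
  obtain k where k: "k \<in> borel_measurable (lborel :: ((real^'n) \<times> (real^'n)) measure)"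
    and ae: "AE z in lborel. (\<lambda>(x, y). K x y) z = k z"
    using borel_measurable_completion_representative[OF K] .
  have "AE z in lborel \<Otimes>\<^sub>M lborel. (\<lambda>(x, y). K x y) z = k z"
    using ae unfolding lborel_prod .
  from lborel_pair.AE_pair[OF this] have "AE x in lborel. AE y in lborel. K x y = k (x, y)" by simp
  then have "AE x in lborel. AE y in lebesgue. K x y = k (x, y)"
    by eventually_elim (rule AE_completion)
  then have "AE x in lebesgue. AE y in lebesgue. K x y = k (x, y)" by (rule AE_completion)
  moreover have "(\<lambda>(x, y). k (x, y)) \<in> borel_measurable (lebesgue \<Otimes>\<^sub>M lebesgue)"
  proof -
    have "(\<lambda>z. z) \<in> (lebesgue \<Otimes>\<^sub>M lebesgue) \<rightarrow>\<^sub>M (borel \<Otimes>\<^sub>M borel :: ((real^'n) \<times> (real^'n)) measure)"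
      by (intro measurable_pair) (auto simp: comp_def)
    then have "(\<lambda>z. z) \<in> (lebesgue \<Otimes>\<^sub>M lebesgue) \<rightarrow>\<^sub>M (borel :: ((real^'n) \<times> (real^'n)) measure)"
      by (simp add: borel_prod)
    from measurable_compose[OF this, of k borel] k show ?thesis by simp
  qed
  ultimately show ?thesis by (intro that[of "\<lambda>x y. k (x, y)"])
qed

section \<open>Kernel estimates on Morrey functions\<close>

context
  fixes p lam c :: real and K :: "real^'n \<Rightarrow> real^'n \<Rightarrow> 'a::{real_normed_field,banach,second_countable_topology}"
  assumes p: "1 < p" and lam: "0 \<le> lam" "lam < real CARD('n)"
    and c: "0 < c" and Kc: "\<And>x y. x \<noteq> y \<Longrightarrow> norm (K x y) \<le> c / norm (x - y) ^ CARD('n)"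
begin

text \<open>\<open>far_integral\<close> cuts at twice its radius argument, hence
  \<open>\<epsilon> / 2\<close>. Finiteness of that tail is what makes the truncated integral of a
  Morrey function absolutely convergent.\<close>

lemma nn_integral_kernel_le:
  assumes [measurable]: "f \<in> borel_measurable lebesgue" and "0 < \<epsilon>"
  shows "(\<integral>\<^sup>+z. ennreal (norm (indicator {z. \<epsilon> < norm (x - z)} z *\<^sub>R (K x z * f z))) \<partial>lebesgue)
    \<le> ennreal c * far_integral f x (\<epsilon> / 2)"
proof -
  have "(\<integral>\<^sup>+z. ennreal (norm (indicator {z. \<epsilon> < norm (x - z)} z *\<^sub>R (K x z * f z))) \<partial>lebesgue)
      \<le> (\<integral>\<^sup>+z. ennreal c * (indicator {z. 2 * (\<epsilon> / 2) \<le> dist x z} z * ennreal (norm (f z) / dist x z ^ CARD('n))) \<partial>lebesgue)"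
  proof (rule nn_integral_mono)
    fix z
    have "norm (K x z * f z) \<le> c * (norm (f z) / dist x z ^ CARD('n))" if "\<epsilon> < norm (x - z)"
    proof -
      have "x \<noteq> z" using that assms by auto
      from mult_right_mono[OF Kc[OF this], of "norm (f z)"] show ?thesis
        by (simp add: norm_mult dist_norm)
    qed
    then show "ennreal (norm (indicator {z. \<epsilon> < norm (x - z)} z *\<^sub>R (K x z * f z)))
      \<le> ennreal c * (indicator {z. 2 * (\<epsilon> / 2) \<le> dist x z} z * ennreal (norm (f z) / dist x z ^ CARD('n)))"
      using c by (auto simp: ennreal_mult[symmetric] dist_norm split: split_indicator intro!: ennreal_leI)
  qed
  also have "\<dots> = ennreal c * far_integral f x (\<epsilon> / 2)"
    unfolding far_integral_def by (rule nn_integral_cmult) measurable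
  finally show ?thesis .
qed

lemma kernel_set_integrable:
  assumes f: "f \<in> morrey_space p lam" and [measurable]: "K x \<in> borel_measurable lebesgue" and \<epsilon>: "0 < \<epsilon>"
  shows "set_integrable lebesgue {z. norm (x - z) > \<epsilon>} (\<lambda>z. K x z * f z)"
  unfolding set_integrable_def
proof (rule integrableI_bounded)
  have [measurable]: "f \<in> borel_measurable lebesgue" using f by (rule morrey_space_measurable)
  show "(\<lambda>z. indicator {z. norm (x - z) > \<epsilon>} z *\<^sub>R (K x z * f z)) \<in> borel_measurable lebesgue" by measurable
  have "ennreal c * far_integral f x (\<epsilon> / 2) < \<infinity>"
    using far_integral_finite[OF p lam f, of "\<epsilon> / 2" x] \<epsilon> by (simp add: ennreal_mult_less_top)
  then show "(\<integral>\<^sup>+z. ennreal (norm (indicator {z. norm (x - z) > \<epsilon>} z *\<^sub>R (K x z * f z))) \<partial>lebesgue) < \<infinity>"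
    by (rule le_less_trans[rotated]) (rule nn_integral_kernel_le[OF _ \<epsilon>], measurable)
qed

text \<open>A point \<open>z\<close> of the far region satisfies |y - z| > r > \<epsilon>, so the
  truncation never reaches it. The second summand does not depend on \<epsilon>, and convergence for
  \<open>f\<close> reduces to convergence for its near part.\<close>

lemma truncated_integral_near_far:
  assumes f: "f \<in> morrey_space p lam" and K[measurable]: "K y \<in> borel_measurable lebesgue"
    and y: "y \<in> ball x r" and \<epsilon>: "0 < \<epsilon>" "\<epsilon> < r"
  shows "truncated_integral K \<epsilon> f y
    = truncated_integral K \<epsilon> (near_part f x r) y + (LINT z:{z. 2 * r \<le> dist x z}|lebesgue. K y z * f z)"
proof -
  have [measurable]: "f \<in> borel_measurable lebesgue" using f by (rule morrey_space_measurable)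
  have far: "\<epsilon> < norm (y - z)" if "2 * r \<le> dist x z" for z
    using that y \<epsilon> dist_triangle[of x z y] by (auto simp: dist_norm)
  have int: "integrable lebesgue (\<lambda>z. indicator {z. norm (y - z) > \<epsilon>} z *\<^sub>R (K y z * f z))"
    using kernel_set_integrable[where f=f and x=y, OF f K \<epsilon>(1)] by (simp add: set_integrable_def)
  have 1: "integrable lebesgue (\<lambda>z. indicator {z. norm (y - z) > \<epsilon>} z *\<^sub>R (K y z * near_part f x r z))"
    by (rule Bochner_Integration.integrable_bound[OF int]) (auto simp: near_part_def split: split_indicator)
  have 2: "integrable lebesgue (\<lambda>z. indicator {z. 2 * r \<le> dist x z} z *\<^sub>R (K y z * f z))"
    by (rule Bochner_Integration.integrable_bound[OF int]) (auto split: split_indicator dest: far)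
  have "(\<lambda>z. indicator {z. norm (y - z) > \<epsilon>} z *\<^sub>R (K y z * f z))
    = (\<lambda>z. indicator {z. norm (y - z) > \<epsilon>} z *\<^sub>R (K y z * near_part f x r z) + indicator {z. 2 * r \<le> dist x z} z *\<^sub>R (K y z * f z))"
    by (rule ext) (auto simp: near_part_def split: split_indicator dest: far)
  then show ?thesis
    unfolding truncated_integral_def set_lebesgue_integral_def
    by (simp add: Bochner_Integration.integral_add[OF 1 2])
qed

text \<open>|x - z| is at most 2 |y - z| in the far region, so recentring the kernel bound from
  \<open>y\<close> to \<open>x\<close> costs \<open>2 ^ n\<close>.\<close>

lemma norm_far_kernel_le:
  assumes [measurable]: "f \<in> borel_measurable lebesgue" and K[measurable]: "K y \<in> borel_measurable lebesgue"
    and r: "0 < r" and y: "y \<in> ball x r"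
  shows "ennreal (norm (LINT z:{z. 2 * r \<le> dist x z}|lebesgue. K y z * f z)) \<le> ennreal (2 ^ CARD('n) * c) * far_integral f x r"
proof (cases "integrable lebesgue (\<lambda>z. indicator {z. 2 * r \<le> dist x z} z *\<^sub>R (K y z * f z))")
  case True
  let ?N = "CARD('n)"
  have "ennreal (norm (LINT z:{z. 2 * r \<le> dist x z}|lebesgue. K y z * f z))
    \<le> (\<integral>\<^sup>+z. ennreal (norm (indicator {z. 2 * r \<le> dist x z} z *\<^sub>R (K y z * f z))) \<partial>lebesgue)"
    unfolding set_lebesgue_integral_def by (rule integral_norm_bound_ennreal[OF True])
  also have "\<dots> \<le> (\<integral>\<^sup>+z. ennreal (2 ^ ?N * c) * (indicator {z. 2 * r \<le> dist x z} z * ennreal (norm (f z) / dist x z ^ ?N)) \<partial>lebesgue)"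
  proof (rule nn_integral_mono)
    fix z
    have "norm (K y z * f z) \<le> 2 ^ ?N * c * (norm (f z) / dist x z ^ ?N)" if z: "2 * r \<le> dist x z"
    proof -
      have d: "0 < dist x z" "dist x z \<le> 2 * dist y z" "0 < dist y z"
        using z y r dist_triangle[of x z y] by (auto simp del: zero_less_dist_iff)
      then have "norm (K y z) \<le> c / dist y z ^ ?N" using Kc[of y z] by (auto simp: dist_norm)
      also have "\<dots> \<le> c / (dist x z / 2) ^ ?N"
        using d c by (intro divide_left_mono power_mono) (auto simp del: zero_less_dist_iff)
      also have "\<dots> = 2 ^ ?N * c / dist x z ^ ?N" by (simp add: power_divide)
      finally have "norm (K y z) * norm (f z) \<le> 2 ^ ?N * c / dist x z ^ ?N * norm (f z)" by (rule mult_right_mono) simp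
      then show ?thesis by (simp add: norm_mult)
    qed
    then show "ennreal (norm (indicator {z. 2 * r \<le> dist x z} z *\<^sub>R (K y z * f z)))
      \<le> ennreal (2 ^ ?N * c) * (indicator {z. 2 * r \<le> dist x z} z * ennreal (norm (f z) / dist x z ^ ?N))"
      using c by (auto simp: ennreal_mult[symmetric] split: split_indicator intro!: ennreal_leI)
  qed
  also have "\<dots> = ennreal (2 ^ ?N * c) * far_integral f x r"
    unfolding far_integral_def by (rule nn_integral_cmult) measurable
  finally show ?thesis .
\<comment> \<open>Without integrability the integral on the left is 0 by convention.\<close>
qed (simp add: set_lebesgue_integral_def not_integrable_integral_eq)

end

lemma near_part_Lp_space:
  fixes f :: "real^'n \<Rightarrow> 'b::{banach,second_countable_topology}"
  assumes f: "f \<in> morrey_space p lam" and r: "0 < r"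
  shows "near_part f x r \<in> Lp_space p"
proof -
  have [measurable]: "f \<in> borel_measurable lebesgue" using f by (rule morrey_space_measurable)
  have "integrable lebesgue (\<lambda>y. norm (near_part f x r y) powr p)"
    using nn_integral_near_part_finite[OF f r, of x] by (intro integrableI_bounded) auto
  then show ?thesis by (simp add: Lp_space_def)
qed

lemma nn_integral_Lp_space:
  fixes f :: "real^'n \<Rightarrow> 'b::{banach,second_countable_topology}"
  assumes f: "f \<in> Lp_space p" and p: "0 < p"
  shows "(\<integral>\<^sup>+y. ennreal (norm (f y) powr p) \<partial>lebesgue) = ennreal (Lp_norm p f powr p)"
proof -
  have "(\<integral>\<^sup>+y. ennreal (norm (f y) powr p) \<partial>lebesgue) = ennreal (LINT y|lebesgue. norm (f y) powr p)"
    using f by (intro nn_integral_eq_integral) (auto simp: Lp_space_def)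
  then show ?thesis using p by (simp add: Lp_norm_def powr_powr)
qed

lemma singular_integral_bounded:
  fixes p lam :: real and K :: "real^'n \<Rightarrow> real^'n \<Rightarrow> 'a::{real_normed_field,banach,second_countable_topology}"
  assumes p: "1 < p" and lam: "0 \<le> lam" "lam < real CARD('n)" and adm: "admissible_kernel p K"
  shows "\<And>f. f \<in> morrey_space p lam \<Longrightarrow> AE x in lebesgue.
             (\<forall>\<epsilon>>0. set_integrable lebesgue {y. norm (x - y) > \<epsilon>} (\<lambda>y. K x y * f y)) \<and>
             (\<exists>l. ((\<lambda>\<epsilon>. truncated_integral K \<epsilon> f x) \<longlongrightarrow> l) (at_right 0))"
    and "bounded_on_vanishing_morrey p lam (singular_integral K)"
proof -
  obtain c where c: "0 < c" and Kc: "\<And>x y. x \<noteq> y \<Longrightarrow> norm (K x y) \<le> c / norm (x - y) ^ CARD('n)"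
    using adm unfolding admissible_kernel_def by blast
  have Kmeas: "(\<lambda>(x, y). K x y) \<in> borel_measurable lebesgue" using adm by (simp add: admissible_kernel_def)
  have Klim: "AE x in lebesgue. \<exists>l. ((\<lambda>\<epsilon>. truncated_integral K \<epsilon> f x) \<longlongrightarrow> l) (at_right 0)" if "f \<in> Lp_space p" for f
    using adm that by (simp add: admissible_kernel_def)
  obtain C0 where C0: "\<And>f. f \<in> Lp_space p \<Longrightarrow> singular_integral K f \<in> Lp_space p"
      "\<And>f. f \<in> Lp_space p \<Longrightarrow> Lp_norm p (singular_integral K f) \<le> C0 * Lp_norm p f"
    using adm unfolding admissible_kernel_def bounded_on_Lp_def by blast
  obtain K' where K'[measurable]: "(\<lambda>(x, y). K' x y) \<in> borel_measurable (lebesgue \<Otimes>\<^sub>M lebesgue)"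
    and KK': "AE x in lebesgue. AE y in lebesgue. K x y = K' x y"
    using kernel_representative[OF Kmeas] .
  have K'x: "K' x \<in> borel_measurable lebesgue" for x
    using measurable_compose_Pair1[OF _ K', of x] by simp
  \<comment> \<open>Measurability of a section of \<open>K\<close> is known for almost every
    \<open>x\<close> only, through its agreement with \<open>K' x\<close>.\<close>
  have good: "AE x in lebesgue. K x \<in> borel_measurable lebesgue \<and> (AE y in lebesgue. K x y = K' x y)"
    using KK'
  proof eventually_elim
    fix x assume K: "AE y in lebesgue. K x y = K' x y"
    then have "AE y in lebesgue. K' x y = K x y" by eventually_elim simp
    then show "K x \<in> borel_measurable lebesgue \<and> (AE y in lebesgue. K x y = K' x y)"
      using borel_measurable_lebesgue_AE_cong[OF K'x] K by blast
  qed
  define far where "far f x r y = (LINT z:{z. 2 * r \<le> dist x z}|lebesgue. K y z * f z)" for f x r y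
  \<comment> \<open>Existence of the limit is assumed on \<open>L^p\<close>, so it is invoked for
    the near part. The exceptional null set may depend on \<open>f\<close>, \<open>x\<close> and
    \<open>r\<close>.\<close>
  have local: "AE y in lebesgue. y \<in> ball x r \<longrightarrow>
      K y \<in> borel_measurable lebesgue \<and> ((\<lambda>\<epsilon>. truncated_integral K \<epsilon> f y) \<longlongrightarrow> singular_integral K f y) (at_right 0)
      \<and> singular_integral K f y = singular_integral K (near_part f x r) y + far f x r y"
    if f: "f \<in> morrey_space p lam" and r: "0 < r" for f x r
    using good Klim[OF near_part_Lp_space[OF f r, of x]]
  proof eventually_elim
    fix y
    assume g: "K y \<in> borel_measurable lebesgue \<and> (AE z in lebesgue. K y z = K' y z)"
      and "\<exists>l. ((\<lambda>\<epsilon>. truncated_integral K \<epsilon> (near_part f x r) y) \<longlongrightarrow> l) (at_right 0)"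
    then obtain l where l: "((\<lambda>\<epsilon>. truncated_integral K \<epsilon> (near_part f x r) y) \<longlongrightarrow> l) (at_right 0)" by blast
    show "y \<in> ball x r \<longrightarrow>
      K y \<in> borel_measurable lebesgue \<and> ((\<lambda>\<epsilon>. truncated_integral K \<epsilon> f y) \<longlongrightarrow> singular_integral K f y) (at_right 0)
      \<and> singular_integral K f y = singular_integral K (near_part f x r) y + far f x r y"
    proof
      assume y: "y \<in> ball x r"
      \<comment> \<open>The far part is the same for every \<epsilon> below \<open>r\<close>, so it
        passes through the limit as a constant.\<close>
      have "\<forall>\<^sub>F \<epsilon> in at_right 0. truncated_integral K \<epsilon> (near_part f x r) y + far f x r y = truncated_integral K \<epsilon> f y"
        unfolding eventually_at_right_field far_def
        using truncated_integral_near_far[where f=f, OF p lam c Kc f conjunct1[OF g] y] r by (intro exI[of _ r]) auto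
      then have lim: "((\<lambda>\<epsilon>. truncated_integral K \<epsilon> f y) \<longlongrightarrow> l + far f x r y) (at_right 0)"
        using tendsto_add[OF l tendsto_const[of "far f x r y"]] by (rule Lim_transform_eventually[rotated])
      have "singular_integral K f y = l + far f x r y" "singular_integral K (near_part f x r) y = l"
        unfolding singular_integral_def using lim l by (auto intro!: tendsto_Lim)
      then show "K y \<in> borel_measurable lebesgue \<and> ((\<lambda>\<epsilon>. truncated_integral K \<epsilon> f y) \<longlongrightarrow> singular_integral K f y) (at_right 0)
        \<and> singular_integral K f y = singular_integral K (near_part f x r) y + far f x r y"
        using lim g by simp
    qed
  qed
  have conv: "AE x in lebesgue. ((\<lambda>\<epsilon>. truncated_integral K \<epsilon> f x) \<longlongrightarrow> singular_integral K f x) (at_right 0)"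
    if f: "f \<in> morrey_space p lam" for f
    by (rule AE_lebesgueI_balls, rule AE_mp[OF local[OF f, where x=0]]) auto
  show "AE x in lebesgue.
             (\<forall>\<epsilon>>0. set_integrable lebesgue {y. norm (x - y) > \<epsilon>} (\<lambda>y. K x y * f y)) \<and>
             (\<exists>l. ((\<lambda>\<epsilon>. truncated_integral K \<epsilon> f x) \<longlongrightarrow> l) (at_right 0))"
    if f: "f \<in> morrey_space p lam" for f
    using good conv[OF f]
    by eventually_elim (auto intro!: kernel_set_integrable[where f=f, OF p lam c Kc f])
  have meas: "singular_integral K f \<in> borel_measurable lebesgue" if f: "f \<in> morrey_space p lam" for f
  proof (rule borel_measurable_lebesgue_AE_cong)
    have [measurable]: "f \<in> borel_measurable lebesgue" using f by (rule morrey_space_measurable)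
    \<comment> \<open>\<open>K'\<close> replaces \<open>K\<close> because its joint measurability
      makes each truncated integral measurable in \<open>x\<close>, and the radii
      \<open>1 / (k + 1)\<close> turn the limit over \<epsilon> into a limit of a sequence.\<close>
    let ?S = "\<lambda>k x. truncated_integral K' (1 / real (Suc k)) f x"
    have "?S k \<in> borel_measurable lebesgue" for k
      unfolding truncated_integral_def[abs_def] set_lebesgue_integral_def by measurable
    then show "(\<lambda>x. lim (\<lambda>k. ?S k x)) \<in> borel_measurable lebesgue" by measurable
    show "AE x in lebesgue. lim (\<lambda>k. ?S k x) = singular_integral K f x"
      using good conv[OF f]
    proof eventually_elim
      fix x assume g: "K x \<in> borel_measurable lebesgue \<and> (AE y in lebesgue. K x y = K' x y)"
        and l: "((\<lambda>\<epsilon>. truncated_integral K \<epsilon> f x) \<longlongrightarrow> singular_integral K f x) (at_right 0)"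
      have [measurable]: "K x \<in> borel_measurable lebesgue" "K' x \<in> borel_measurable lebesgue" using g K'x by auto
      have eq: "truncated_integral K \<epsilon> f x = truncated_integral K' \<epsilon> f x" for \<epsilon>
        unfolding truncated_integral_def set_lebesgue_integral_def
      proof (rule integral_cong_AE)
        show "AE y in lebesgue. indicator {y. \<epsilon> < norm (x - y)} y *\<^sub>R (K x y * f y) = indicator {y. \<epsilon> < norm (x - y)} y *\<^sub>R (K' x y * f y)"
          using conjunct2[OF g] by eventually_elim simp
      qed measurable
      have "filterlim (\<lambda>k. 1 / real (Suc k)) (at_right 0) sequentially"
        using LIMSEQ_Suc[OF lim_inverse_n'] by (auto simp: filterlim_at)
      from filterlim_compose[OF l this] show "lim (\<lambda>k. ?S k x) = singular_integral K f x"
        unfolding eq by (rule limI)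
    qed
  qed
  show "bounded_on_vanishing_morrey p lam (singular_integral K)"
  proof (rule bounded_on_vanishing_morrey_near_far[OF p lam, where A="max C0 0 powr p" and D="2 ^ CARD('n) * c"])
    fix f :: "real^'n \<Rightarrow> 'a" and x :: "real^'n" and r :: real
    assume f: "f \<in> morrey_space p lam" and r: "0 < r"
    have [measurable]: "f \<in> borel_measurable lebesgue" using f by (rule morrey_space_measurable)
    let ?u = "near_part f x r"
    have u: "?u \<in> Lp_space p" by (rule near_part_Lp_space[OF f r])
    have [measurable]: "singular_integral K ?u \<in> borel_measurable lebesgue" using C0(1)[OF u] by (simp add: Lp_space_def)
    have u0: "0 \<le> Lp_norm p ?u" by (simp add: Lp_norm_def)
    \<comment> \<open>The constant in \<open>bounded_on_Lp\<close> carries no sign;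
      \<open>max C0 0\<close> makes the right-hand side nonnegative before taking
      \<open>p\<close>-th powers.\<close>
    have "Lp_norm p (singular_integral K ?u) \<le> max C0 0 * Lp_norm p ?u"
      using C0(2)[OF u] mult_right_mono[OF max.cobounded1 u0, of C0 0] by linarith
    then have "Lp_norm p (singular_integral K ?u) powr p \<le> (max C0 0 * Lp_norm p ?u) powr p"
      using p by (intro powr_mono2) (auto simp: Lp_norm_def)
    then have Lp: "(\<integral>\<^sup>+y. ennreal (norm (singular_integral K ?u y) powr p) \<partial>lebesgue)
        \<le> ennreal (max C0 0 powr p) * (\<integral>\<^sup>+y. ennreal (norm (?u y) powr p) \<partial>lebesgue)"
      using p u0 by (simp add: nn_integral_Lp_space[OF C0(1)[OF u]] nn_integral_Lp_space[OF u] ennreal_mult[symmetric] powr_mult ennreal_leI)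
    show "\<exists>g :: real^'n \<Rightarrow> real. g \<in> borel_measurable lebesgue \<and> (\<forall>y. 0 \<le> g y)
        \<and> (\<integral>\<^sup>+y. ennreal (g y powr p) \<partial>lebesgue)
            \<le> ennreal (max C0 0 powr p) * (\<integral>\<^sup>+y\<in>ball x (2 * r). ennreal (norm (f y) powr p) \<partial>lebesgue)
        \<and> (AE y in lebesgue. y \<in> ball x r \<longrightarrow> ennreal (norm (singular_integral K f y)) \<le> ennreal (g y) + ennreal (2 ^ CARD('n) * c) * far_integral f x r)"
    proof (intro exI[of _ "\<lambda>y. norm (singular_integral K ?u y)"] conjI allI)
      show "(\<integral>\<^sup>+y. ennreal (norm (singular_integral K ?u y) powr p) \<partial>lebesgue)
            \<le> ennreal (max C0 0 powr p) * (\<integral>\<^sup>+y\<in>ball x (2 * r). ennreal (norm (f y) powr p) \<partial>lebesgue)"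
        using Lp by (simp only: nn_integral_near_part)
      show "AE y in lebesgue. y \<in> ball x r \<longrightarrow>
          ennreal (norm (singular_integral K f y)) \<le> ennreal (norm (singular_integral K ?u y)) + ennreal (2 ^ CARD('n) * c) * far_integral f x r"
        using local[OF f r, of x]
      proof (rule AE_mp, intro AE_I2 impI)
        fix y
        assume *: "y \<in> ball x r \<longrightarrow>
            K y \<in> borel_measurable lebesgue \<and> ((\<lambda>\<epsilon>. truncated_integral K \<epsilon> f y) \<longlongrightarrow> singular_integral K f y) (at_right 0)
            \<and> singular_integral K f y = singular_integral K ?u y + far f x r y" and y: "y \<in> ball x r"
        have "ennreal (norm (singular_integral K f y)) \<le> ennreal (norm (singular_integral K ?u y)) + ennreal (norm (far f x r y))"
          using * y by (auto simp: ennreal_plus[symmetric] simp del: ennreal_plus intro!: ennreal_leI norm_triangle_ineq)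
        also have "ennreal (norm (far f x r y)) \<le> ennreal (2 ^ CARD('n) * c) * far_integral f x r"
          unfolding far_def using * y
          by (intro norm_far_kernel_le[where f=f, OF p lam c Kc _ _ r y]) auto
        finally show "ennreal (norm (singular_integral K f y)) \<le> ennreal (norm (singular_integral K ?u y)) + ennreal (2 ^ CARD('n) * c) * far_integral f x r"
          by (simp add: add_left_mono)
      qed
    qed auto
  qed (use c meas in auto)
qed

text \<open>Each operator takes a default value where its defining expression fails:
  \<open>enn2real\<close> sends infinity to 0, a non-integrable integral is 0, and
  \<open>Lim\<close> is unspecified without a limit. The a.e. clauses paired with the bounds certify
  that such defaults occur on null sets only, so the bounds concern the genuine operators.\<close>

theorem corollary3p2:
  fixes p lam :: real
  assumes "1 < p" and "0 \<le> lam" and "lam < real CARD('n::finite)"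
  shows
    "((\<forall>f :: real^'n \<Rightarrow> 'a::{real_normed_field,banach,second_countable_topology}.
         f \<in> vanishing_morrey_space p lam \<longrightarrow> (AE x in lebesgue. maximal_function f x < \<infinity>)) \<and>
       bounded_on_vanishing_morrey p lam
         (\<lambda>(f :: real^'n \<Rightarrow> 'a) x. enn2real (maximal_function f x)))
    \<and>
     ((\<forall>f :: real^'n \<Rightarrow> 'a.
         f \<in> vanishing_morrey_space p lam \<longrightarrow>
           (AE x in lebesgue. sharp_maximal_function f x < \<infinity>)) \<and>
       bounded_on_vanishing_morrey p lam
         (\<lambda>(f :: real^'n \<Rightarrow> 'a) x. enn2real (sharp_maximal_function f x)))
    \<and>
     ((\<forall>f :: real^'n \<Rightarrow> 'a.
         f \<in> vanishing_morrey_space p lam \<longrightarrow>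
           (AE x :: real^'n in lebesgue. set_integrable lebesgue {y. norm y < norm x} f)) \<and>
       bounded_on_vanishing_morrey p lam (hardy_operator :: (real^'n \<Rightarrow> 'a) \<Rightarrow> real^'n \<Rightarrow> 'a))
    \<and>
     ((\<forall>f :: real^'n \<Rightarrow> 'a.
         f \<in> vanishing_morrey_space p lam \<longrightarrow>
           (AE x :: real^'n in lebesgue. set_integrable lebesgue {y. norm y > norm x}
              (\<lambda>y. (1 / norm y ^ CARD('n)) *\<^sub>R f y))) \<and>
       bounded_on_vanishing_morrey p lam
         (dual_hardy_operator :: (real^'n \<Rightarrow> 'a) \<Rightarrow> real^'n \<Rightarrow> 'a))
    \<and>
     (\<forall>K :: real^'n \<Rightarrow> real^'n \<Rightarrow> 'a. admissible_kernel p K \<longrightarrow>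
       (\<forall>f. f \<in> vanishing_morrey_space p lam \<longrightarrow>
          (AE x in lebesgue.
             (\<forall>\<epsilon>>0. set_integrable lebesgue {y. norm (x - y) > \<epsilon>} (\<lambda>y. K x y * f y)) \<and>
             (\<exists>l. ((\<lambda>\<epsilon>. truncated_integral K \<epsilon> f x) \<longlongrightarrow> l) (at_right 0)))) \<and>
       bounded_on_vanishing_morrey p lam (singular_integral K))"
proof (intro conjI allI impI)
  have V: "f \<in> morrey_space p lam" if "f \<in> vanishing_morrey_space p lam" for f :: "real^'n \<Rightarrow> 'a"
    using that by (simp add: vanishing_morrey_space_def)
  note p = \<open>1 < p\<close> and lam = \<open>0 \<le> lam\<close> \<open>lam < real CARD('n)\<close>
  fix f :: "real^'n \<Rightarrow> 'a" assume "f \<in> vanishing_morrey_space p lam"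
  then have f: "f \<in> morrey_space p lam" by (rule V)
  note f' = morrey_space_measurable[OF f] morrey_set_integrable_compact[OF f p]
  show M: "AE x in lebesgue. maximal_function f x < \<infinity>"
    by (rule AE_maximal_function_finite_morrey[OF p lam f])
  show "AE x in lebesgue. sharp_maximal_function f x < \<infinity>"
    using M
  proof eventually_elim
    fix x assume "maximal_function f x < \<infinity>"
    then have "2 * maximal_function f x < \<infinity>" by (simp add: ennreal_mult_less_top)
    moreover have "sharp_maximal_function f x \<le> 2 * maximal_function f x"
      by (rule sharp_maximal_function_le[OF f'])
    ultimately show "sharp_maximal_function f x < \<infinity>" by (rule le_less_trans[rotated])
  qed
  show "AE x :: real^'n in lebesgue. set_integrable lebesgue {y. norm y < norm x} f"
  proof (rule AE_I2)
    fix x :: "real^'n"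
    have "set_integrable lebesgue (cball 0 (norm x)) f" by (rule f'(2)) simp
    then have "set_integrable lebesgue (ball 0 (norm x)) f" by (rule set_integrable_subset) auto
    moreover have "{y::real^'n. norm y < norm x} = ball 0 (norm x)" by auto
    ultimately show "set_integrable lebesgue {y. norm y < norm x} f" by simp
  qed
  show "AE x :: real^'n in lebesgue. set_integrable lebesgue {y. norm y > norm x}
      (\<lambda>y. (1 / norm y ^ CARD('n)) *\<^sub>R f y)"
    using AE_lebesgue_neq[of 0] by eventually_elim (rule dual_hardy_set_integrable[OF p lam f])
  show "AE x in lebesgue.
      (\<forall>\<epsilon>>0. set_integrable lebesgue {y. norm (x - y) > \<epsilon>} (\<lambda>y. K x y * f y)) \<and>
      (\<exists>l. ((\<lambda>\<epsilon>. truncated_integral K \<epsilon> f x) \<longlongrightarrow> l) (at_right 0))"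
    if "admissible_kernel p K" for K
    by (rule singular_integral_bounded(1)[OF p lam that f])
qed (intro maximal_function_bounded sharp_maximal_function_bounded hardy_operator_bounded
    dual_hardy_operator_bounded singular_integral_bounded(2) assms; assumption)+

end
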